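(* Let $G=(V,E)$ be a simple undirected graph with $V=[n]$, $N=\binom n2$, $\mathcal P_n=\{(i,j):i<j\}$ enumerated as $(i_k,j_k)$, $k\in[N]$, $\sigma^*$ a permutation of $[n]$ and $y_k=\operatorname{sign}(\sigma^*(i_k)-\sigma^*(j_k))$. Let $U=[u_1,\dots,u_n]\in\mathrm{Lab}(G)$, $K=U^\top U$, and let $\tilde U\in\mathbb R^{d\times N}$ have columns $\tilde u_k=u_{i_k}-u_{j_k}$. Fix $C>0$, $f\in(0,1/2]$, $m=\lceil Nf\rceil$, let $S\subseteq\mathcal P_n$ with $|S|=m$ be drawn uniformly at random with labels revealed, $\bar S=\mathcal P_n\setminus S$, and let $\ell^\rho:\{\pm1\}\times\mathbb R\to[0,B]$ be a bounded loss, $\rho$-Lipschitz in its second argument. Let $f^*=\tilde U^\top w^*$ be the score vector output by Pref-Rank on $(\tilde U,S,\{y_k\}_{k\in S})$. Then there is a constant $C_1>0$ such that for any $\delta>0$, with probability at least $1-\delta$ over $S$, $$er^{\ell^\rho}_{\bar S}(f^* )\le er^{\ell^\rho}_S(f^* )+\frac{2C\sqrt{n\lambda_1(K)}}{\rho\sqrt{f(1-f)}}+\frac{C_1B}{1-f}\sqrt{\frac{\log(1/\delta)}{Nf}}.$$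
   Context: $\mathrm{Lab}(G)$: matrices $U=[u_1,\dots,u_n]\in\mathbb R^{d\times n}$ with unit columns and $u_i^\top u_j=0$ whenever $i\ne j$, $(i,j)\notin E$. $\lambda_1(K)$ is the largest eigenvalue of $K$. $\rho$-Lipschitz: $|\ell^\rho(y,a)-\ell^\rho(y,a')|\le\frac1\rho|a-a'|$. Pref-Rank with embedding $\tilde U$ and parameter $C$: $w^*\in\arg\min_w\frac12\|w\|_2^2+C\sum_{k\in S}\max(0,1-y_kw^\top\tilde u_k)$, output $f^*=\tilde U^\top w^*$. $er^\ell_S(g)=\frac1{|S|}\sum_{k\in S}\ell(y_k,g_k)$, $er^\ell_{\bar S}(g)=\frac1{|\bar S|}\sum_{k\in\bar S}\ell(y_k,g_k)$. *)

theory Defs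
  imports "Jordan_Normal_Form.Char_Poly" "HOL-Probability.Probability_Mass_Function"
begin

definition simple_graph :: "nat \<Rightarrow> (nat \<Rightarrow> nat \<Rightarrow> bool) \<Rightarrow> bool" where
  "simple_graph n E \<longleftrightarrow> (\<forall>i j. E i j \<longrightarrow> i < n \<and> j < n \<and> i \<noteq> j \<and> E j i)"

definition Lab :: "nat \<Rightarrow> (nat \<Rightarrow> nat \<Rightarrow> bool) \<Rightarrow> nat \<Rightarrow> real mat \<Rightarrow> bool" where
  "Lab n E d U \<longleftrightarrow> U \<in> carrier_mat d n \<and>
     (\<forall>i<n. scalar_prod (col U i) (col U i) = 1) \<and>
     (\<forall>i<n. \<forall>j<n. i \<noteq> j \<and> \<not> E i j \<longrightarrow> scalar_prod (col U i) (col U j) = 0)"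

definition lambda1 :: "real mat \<Rightarrow> real" where
  "lambda1 K = Max {k. eigenvalue K k}"

definition pairs :: "nat \<Rightarrow> (nat \<times> nat) set" where
  "pairs n = {(i, j). i < j \<and> j < n}"

definition pref_label :: "(nat \<Rightarrow> nat) \<Rightarrow> nat \<times> nat \<Rightarrow> real" where
  "pref_label \<sigma> p = sgn (real (\<sigma> (fst p)) - real (\<sigma> (snd p)))"

definition utilde :: "real mat \<Rightarrow> nat \<times> nat \<Rightarrow> real Matrix.vec" where
  "utilde U p = col U (fst p) - col U (snd p)"

definition prefrank_obj :: "real mat \<Rightarrow> real \<Rightarrow> (nat \<times> nat \<Rightarrow> real) \<Rightarrow> (nat \<times> nat) set \<Rightarrow> real Matrix.vec \<Rightarrow> real" where
  "prefrank_obj U C y S w = (1/2) * scalar_prod w w + C * (\<Sum>k\<in>S. max 0 (1 - y k * scalar_prod w (utilde U k)))"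

definition prefrank_argmin :: "nat \<Rightarrow> real mat \<Rightarrow> real \<Rightarrow> (nat \<times> nat \<Rightarrow> real) \<Rightarrow> (nat \<times> nat) set \<Rightarrow> real Matrix.vec \<Rightarrow> bool" where
  "prefrank_argmin d U C y S w \<longleftrightarrow> w \<in> carrier_vec d \<and>
     (\<forall>v \<in> carrier_vec d. prefrank_obj U C y S w \<le> prefrank_obj U C y S v)"

definition prefrank_scores :: "real mat \<Rightarrow> real Matrix.vec \<Rightarrow> nat \<times> nat \<Rightarrow> real" where
  "prefrank_scores U w k = scalar_prod w (utilde U k)"

definition er :: "(real \<Rightarrow> real \<Rightarrow> real) \<Rightarrow> (nat \<times> nat \<Rightarrow> real) \<Rightarrow> (nat \<times> nat) set \<Rightarrow> (nat \<times> nat \<Rightarrow> real) \<Rightarrow> real" where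
  "er l y T g = (1 / real (card T)) * (\<Sum>k\<in>T. l (y k) (g k))"

end

theory Submission
  imports Defs "HOL-Combinatorics.Permutations" "Jordan_Normal_Form.Spectral_Radius"
begin

text \<open>
  A Pref-Rank minimizer \<open>w\<close> for a training set of size \<open>m\<close> satisfies
  \<open>\<parallel>w\<parallel>\<^sup>2 \<le> C (\<Sum>k\<in>S. \<bar>w \<bullet> utilde U k\<bar>)\<close>, and
  \<open>(\<Sum>k. (w \<bullet> utilde U k)\<^sup>2) \<le> n \<lambda>\<^sub>1(K) \<parallel>w\<parallel>\<^sup>2\<close> because the Laplacian of the
  complete graph is at most \<open>n\<close>; hence \<open>\<parallel>w\<parallel> \<le> R = C sqrt (m n \<lambda>\<^sub>1(K))\<close>. The largest gap between test
  and training error over such \<open>w\<close> changes by at most \<open>B (1/m + 1/u)\<close>, where \<open>u\<close> is the size of the test set,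
  when one element of \<open>S\<close> is exchanged, so it concentrates around its mean. The mean is compared with that for disjoint sets of equal
  size \<open>r = min m u\<close>, where random swaps of matched elements introduce independent signs; the contraction
  principle and \<open>(\<Sum>k. \<parallel>utilde U k\<parallel>\<^sup>2) \<le> n\<^sup>2\<close> bound it by \<open>(2 R / \<rho>) sqrt (3 / r)\<close>. Since
  \<open>3 m / r \<le> 4 \<le> 1 / (f (1 - f))\<close>, this is the claimed complexity term, except for \<open>n = 3\<close>, \<open>m = 2\<close>, which is
  treated by a direct estimate around \<open>w = 0\<close>.
\<close>

section \<open>Finite averages and random subsets\<close>

text \<open>The factor 2 C in the complexity term is prescribed, while the constant of the deviation
  term is free, so all slack has to go into the latter. The squared feature norm therefore enters
  only through its mean, at most n^2 / N = 2 n / (n - 1) \<le> 3 for n \<ge> 3, although a single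
  squared norm can reach 4. The room between 3 and 4 pays for the rounding up in m: the training set
  may exceed the test set by one element, and 3 (r + 1) / r \<le> 4 holds exactly when r \<ge> 3.
  Three vertices with two observed pairs give r = 1 and the value 6, hence the separate estimate
  there. A second obstacle is that \<open>lambda1\<close> is a maximum over real eigenvalues, while
  existence of eigenvalues and the spectral radius belong to the complex matrix. For a Gram matrix
  the two spectra agree, and the Rayleigh bound is then drawn from boundedness of matrix powers
  instead of a diagonalization.\<close>

definition avg :: "'a set \<Rightarrow> ('a \<Rightarrow> real) \<Rightarrow> real" where
  "avg A f = (\<Sum>a\<in>A. f a) / real (card A)"

lemma avg_cong: "A = B \<Longrightarrow> (\<And>x. x \<in> B \<Longrightarrow> f x = g x) \<Longrightarrow> avg A f = avg B g"
  by (simp add: avg_def)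

lemma avg_mono: "(\<And>x. x \<in> A \<Longrightarrow> f x \<le> g x) \<Longrightarrow> avg A f \<le> avg A g"
  unfolding avg_def by (intro divide_right_mono sum_mono) auto

lemma avg_const [simp]: "finite A \<Longrightarrow> A \<noteq> {} \<Longrightarrow> avg A (\<lambda>_. c) = c"
  by (simp add: avg_def)

lemma avg_add: "avg A (\<lambda>x. f x + g x) = avg A f + avg A g"
  by (simp add: avg_def sum.distrib add_divide_distrib)

lemma avg_diff: "avg A (\<lambda>x. f x - g x) = avg A f - avg A g"
  by (simp add: avg_def sum_subtractf diff_divide_distrib)

lemma avg_cmult: "avg A (\<lambda>x. c * f x) = c * avg A f"
  by (simp add: avg_def sum_distrib_left)

lemma avg_divide: "avg A (\<lambda>x. f x / c) = avg A f / c"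
  by (simp add: avg_def sum_divide_distrib mult.commute)

lemma avg_sum_swap: "avg A (\<lambda>a. \<Sum>b\<in>B. f a b) = (\<Sum>b\<in>B. avg A (\<lambda>a. f a b))"
  unfolding avg_def by (subst sum.swap) (simp add: sum_divide_distrib)

lemma avg_avg_swap: "avg A (\<lambda>a. avg B (f a)) = avg B (\<lambda>b. avg A (\<lambda>a. f a b))"
  unfolding avg_def
  by (simp add: sum_divide_distrib[symmetric] sum.swap[of f B A] mult.commute)

lemma avg_reindex: "bij_betw h A B \<Longrightarrow> avg A (\<lambda>x. f (h x)) = avg B f"
  by (simp add: avg_def sum.reindex_bij_betw bij_betw_same_card)

lemma avg_image: "inj_on h A \<Longrightarrow> avg (h ` A) f = avg A (\<lambda>x. f (h x))"
  by (metis avg_reindex bij_betw_imageI)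

lemma avg_nonneg: "(\<And>x. x \<in> A \<Longrightarrow> 0 \<le> f x) \<Longrightarrow> 0 \<le> avg A f"
  by (simp add: avg_def sum_nonneg)

lemma avg_abs_diff_le:
  assumes "finite A" "A \<noteq> {}" "\<And>x. x \<in> A \<Longrightarrow> \<bar>f x - g x\<bar> \<le> c"
  shows "\<bar>avg A f - avg A g\<bar> \<le> c"
proof -
  have "avg A f - avg A g \<le> avg A (\<lambda>_. c)"
    unfolding avg_diff[symmetric] by (rule avg_mono) (use assms(3) abs_le_D1 in blast)
  moreover have "avg A g - avg A f \<le> avg A (\<lambda>_. c)"
    unfolding avg_diff[symmetric] by (rule avg_mono) (use assms(3) in fastforce)
  ultimately show ?thesis using assms by simp
qed

section \<open>Maxima over a finite index set\<close>

lemma MAX_leI: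
  fixes g :: "'a \<Rightarrow> real"
  assumes "finite W" "W \<noteq> {}" "\<And>w. w \<in> W \<Longrightarrow> g w \<le> c"
  shows "(MAX w\<in>W. g w) \<le> c"
  using assms by (intro Max.boundedI) auto

lemma MAX_geI:
  fixes g :: "'a \<Rightarrow> real"
  assumes "finite W" "w \<in> W"
  shows "g w \<le> (MAX w\<in>W. g w)"
  using assms by (intro Max_ge) auto

lemma MAX_attained:
  fixes g :: "'a \<Rightarrow> real"
  assumes "finite W" "W \<noteq> {}"
  obtains w where "w \<in> W" "(MAX w\<in>W. g w) = g w"
proof -
  have "(MAX w\<in>W. g w) \<in> g ` W" using assms by (intro Max_in) auto
  then show ?thesis using that by blast
qed

lemma MAX_avg_le:
  assumes "finite W" "W \<noteq> {}"
  shows "(MAX w\<in>W. avg A (\<lambda>a. f a w)) \<le> avg A (\<lambda>a. MAX w\<in>W. f a w)"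
  using assms by (intro MAX_leI avg_mono MAX_geI) auto

lemma MAX_diff_le:
  fixes f g :: "'a \<Rightarrow> real"
  assumes "finite W" "W \<noteq> {}" "\<And>w. w \<in> W \<Longrightarrow> f w \<le> g w + c"
  shows "(MAX w\<in>W. f w) \<le> (MAX w\<in>W. g w) + c"
  by (intro MAX_leI assms(1,2) order.trans[OF assms(3)] add_right_mono MAX_geI) auto

section \<open>Uniform subsets of fixed size and uniform permutations\<close>

lemma finite_card_subsets: "finite P \<Longrightarrow> finite {S. S \<subseteq> P \<and> card S = m}"
  by (rule finite_subset[of _ "Pow P"]) auto

lemma card_subsets_nonempty:
  assumes "finite P" "m \<le> card P"
  shows "{S. S \<subseteq> P \<and> card S = m} \<noteq> {}"
  using n_subsets[OF assms(1), of m] assms(2) by (metis binomial_eq_0_iff card.empty not_le)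

lemma bij_betw_card_subsets:
  assumes "finite P" "bij_betw h P P'"
  shows "bij_betw (image h) {S. S \<subseteq> P \<and> card S = m} {S. S \<subseteq> P' \<and> card S = m}"
proof -
  have inj: "inj_on h P" and im: "h ` P = P'" using assms(2) by (auto simp: bij_betw_def)
  show ?thesis unfolding bij_betw_def
  proof
    show "inj_on (image h) {S. S \<subseteq> P \<and> card S = m}"
      using inj by (intro inj_onI) (metis (mono_tags, lifting) inj_on_image_eq_iff mem_Collect_eq)
    show "(image h) ` {S. S \<subseteq> P \<and> card S = m} = {S. S \<subseteq> P' \<and> card S = m}" (is "?L = ?R")
    proof
      show "?L \<subseteq> ?R" using inj im by (auto simp: card_image inj_on_subset)
      show "?R \<subseteq> ?L"
      proof
        fix T assume T: "T \<in> ?R"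
        then have "T \<subseteq> h ` P" using im by auto
        then obtain S where S: "S \<subseteq> P" "T = h ` S" by (auto simp: subset_image_iff)
        then have "card S = m" using T inj by (metis (mono_tags, lifting) card_image inj_on_subset mem_Collect_eq)
        then show "T \<in> ?L" using S by auto
      qed
    qed
  qed
qed

lemma permutations_nonempty: "{p. p permutes P} \<noteq> {}"
  using permutes_id by blast

text \<open>A permutation of \<open>P\<close> only rearranges the subsets of size \<open>m\<close>,
  so an extra random permutation is free. With \<open>S\<close> then held fixed, all randomness lies
  in the permutation, where exchanges of elements become compositions.\<close>

lemma avg_subsets_permutes:
  assumes "finite P"
  shows "avg {S. S \<subseteq> P \<and> card S = m} F
    = avg {S. S \<subseteq> P \<and> card S = m} (\<lambda>S. avg {p. p permutes P} (\<lambda>p. F (p ` S)))"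
proof -
  let ?C = "{S. S \<subseteq> P \<and> card S = m}" and ?G = "{p. p permutes P}"
  have "avg ?C (\<lambda>S. avg ?G (\<lambda>p. F (p ` S))) = avg ?G (\<lambda>p. avg ?C (\<lambda>S. F (p ` S)))"
    by (rule avg_avg_swap)
  also have "\<dots> = avg ?G (\<lambda>p. avg ?C F)"
  proof (rule avg_cong[OF refl])
    fix p assume "p \<in> ?G"
    then have "bij_betw p P P" by (simp add: permutes_imp_bij)
    from avg_reindex[OF bij_betw_card_subsets[OF assms this]]
    show "avg ?C (\<lambda>S. F (p ` S)) = avg ?C F" .
  qed
  also have "\<dots> = avg ?C F"
    using assms by (intro avg_const finite_permutations permutations_nonempty) 
  finally show ?thesis by simp
qed

lemma avg_permutes_compose:
  assumes "q permutes P"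
  shows "avg {p. p permutes P} (\<lambda>p. F (p \<circ> q)) = avg {p. p permutes P} F"
proof (rule avg_reindex)
  show "bij_betw (\<lambda>p. p \<circ> q) {p. p permutes P} {p. p permutes P}"
  proof (rule bij_betwI[where g="\<lambda>p. p \<circ> inv_into UNIV q"])
    show "(\<lambda>p. p \<circ> q) \<in> {p. p permutes P} \<rightarrow> {p. p permutes P}"
      using assms by (auto intro: permutes_compose)
    show "(\<lambda>p. p \<circ> inv_into UNIV q) \<in> {p. p permutes P} \<rightarrow> {p. p permutes P}"
      using assms by (auto intro: permutes_compose permutes_inv)
    show "p \<circ> q \<circ> inv_into UNIV q = p" for p
      using permutes_inv_o(1)[OF assms] by (simp add: o_assoc[symmetric])
    show "p \<circ> inv_into UNIV q \<circ> q = p" for p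
      using permutes_inv_o(2)[OF assms] by (simp add: o_assoc[symmetric])
  qed
qed

text \<open>Composing with the transposition of \<open>j\<close> and \<open>k\<close> is an
  involution of \<open>Q\<close>, so the images of \<open>j\<close> and of \<open>k\<close> have the
  same distribution. Averaging over all \<open>j\<close> in \<open>A\<close> gives the claim,
  because each \<open>q\<close> merely rearranges \<open>A\<close>. It serves both the full
  permutation group and a stabilizer of two disjoint sets.\<close>

lemma avg_transitive_family:
  assumes "finite A" "k \<in> A" "finite Q" "Q \<noteq> {}"
    and bij: "\<And>q. q \<in> Q \<Longrightarrow> bij_betw q A A"
    and closed: "\<And>q j. q \<in> Q \<Longrightarrow> j \<in> A \<Longrightarrow> q \<circ> Transposition.transpose j k \<in> Q"
  shows "avg Q (\<lambda>q. h (q k)) = avg A h"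
proof -
  have same: "avg Q (\<lambda>q. h (q j)) = avg Q (\<lambda>q. h (q k))" if "j \<in> A" for j
  proof -
    have "bij_betw (\<lambda>q. q \<circ> Transposition.transpose j k) Q Q"
      by (rule bij_betwI[where g="\<lambda>q. q \<circ> Transposition.transpose j k"])
        (use closed that in \<open>auto simp: o_assoc[symmetric]\<close>)
    from avg_reindex[OF this, of "\<lambda>q. h (q j)"] show ?thesis by simp
  qed
  have "avg Q (\<lambda>q. h (q k)) = avg A (\<lambda>j. avg Q (\<lambda>q. h (q j)))"
  proof -
    have "A \<noteq> {}" using assms(2) by auto
    with assms(1) show ?thesis by (subst avg_cong[OF refl same]) auto
  qed
  also have "\<dots> = avg Q (\<lambda>q. avg A (\<lambda>j. h (q j)))" by (rule avg_avg_swap)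
  also have "\<dots> = avg Q (\<lambda>q. avg A h)"
    by (rule avg_cong[OF refl avg_reindex[OF bij]])
  also have "\<dots> = avg A h" using assms by simp
  finally show ?thesis .
qed

lemma avg_permutes_apply:
  assumes "finite P" "k \<in> P"
  shows "avg {p. p permutes P} (\<lambda>p. h (p k)) = avg P h"
  using assms
  by (intro avg_transitive_family finite_permutations permutations_nonempty)
    (auto intro: permutes_imp_bij permutes_compose permutes_swap_id)

text \<open>Averaging over the permutations that preserve \<open>X\<close> and \<open>Y\<close> turns averages over
  \<open>X0\<close>, \<open>Y0\<close> into averages over \<open>X\<close>, \<open>Y\<close>; then the maximum of an average is at most the average of the maxima.\<close>

lemma avg_MAX_shrink:
  fixes l :: "'k \<Rightarrow> 'w \<Rightarrow> real"
  assumes P: "finite P" and XY: "X \<subseteq> P" "Y \<subseteq> P" "X \<inter> Y = {}"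
    and X0: "X0 \<subseteq> X" "X0 \<noteq> {}" and Y0: "Y0 \<subseteq> Y" "Y0 \<noteq> {}" and W: "finite W" "W \<noteq> {}"
  shows "avg {p. p permutes P} (\<lambda>p. MAX w\<in>W. avg X (\<lambda>k. l (p k) w) - avg Y (\<lambda>k. l (p k) w))
    \<le> avg {p. p permutes P} (\<lambda>p. MAX w\<in>W. avg X0 (\<lambda>k. l (p k) w) - avg Y0 (\<lambda>k. l (p k) w))"
proof -
  let ?G = "{p. p permutes P}"
  let ?F = "\<lambda>p w. avg X (\<lambda>k. l (p k) w) - avg Y (\<lambda>k. l (p k) w)"
  let ?H = "\<lambda>p w. avg X0 (\<lambda>k. l (p k) w) - avg Y0 (\<lambda>k. l (p k) w)"
  \<comment> \<open>Since \<open>X\<close> and \<open>Y\<close> are disjoint, a transposition inside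
    one of them fixes the other pointwise, so \<open>Q\<close> is closed under composition with
    transpositions of either kind.\<close>
  define Q where "Q = {q. q permutes P \<and> q ` X = X \<and> q ` Y = Y}"
  have finQ: "finite Q"
    by (rule finite_subset[OF _ finite_permutations[OF P]]) (auto simp: Q_def)
  have neQ: "Q \<noteq> {}" by (auto simp: Q_def intro: exI[of _ id])
  have fin: "finite X" "finite Y" using P XY by (auto intro: finite_subset)
  have transp_X: "q \<circ> Transposition.transpose j k \<in> Q" if "q \<in> Q" "j \<in> X" "k \<in> X" for q j k
  proof -
    have "Transposition.transpose j k ` X = X" using that by (simp add: transpose_image_eq)
    moreover have "Transposition.transpose j k ` Y = Y"
      using that XY(3) by (subst transpose_image_eq) auto
    moreover have "q \<circ> Transposition.transpose j k permutes P"
      using that XY by (intro permutes_compose permutes_swap_id) (auto simp: Q_def)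
    moreover have "(q \<circ> Transposition.transpose j k) ` Z = q ` (Transposition.transpose j k ` Z)" for Z
      by (rule image_comp[symmetric])
    ultimately show ?thesis using that(1) unfolding Q_def mem_Collect_eq by metis
  qed
  have transp_Y: "q \<circ> Transposition.transpose j k \<in> Q" if "q \<in> Q" "j \<in> Y" "k \<in> Y" for q j k
  proof -
    have "Transposition.transpose j k ` Y = Y" using that by (simp add: transpose_image_eq)
    moreover have "Transposition.transpose j k ` X = X"
      using that XY(3) by (subst transpose_image_eq) auto
    moreover have "q \<circ> Transposition.transpose j k permutes P"
      using that XY by (intro permutes_compose permutes_swap_id) (auto simp: Q_def)
    moreover have "(q \<circ> Transposition.transpose j k) ` Z = q ` (Transposition.transpose j k ` Z)" for Z
      by (rule image_comp[symmetric])
    ultimately show ?thesis using that(1) unfolding Q_def mem_Collect_eq by metis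
  qed
  have bij: "bij_betw q X X" "bij_betw q Y Y" if "q \<in> Q" for q
    using that by (auto simp: Q_def bij_betw_def intro: permutes_inj_on)
  have avg_X: "avg Q (\<lambda>q. avg X0 (\<lambda>k. h (q k))) = avg X h" for h
  proof -
    have "avg Q (\<lambda>q. avg X0 (\<lambda>k. h (q k))) = avg X0 (\<lambda>k. avg Q (\<lambda>q. h (q k)))"
      by (rule avg_avg_swap)
    also have "\<dots> = avg X0 (\<lambda>k. avg X h)"
      using X0 by (intro avg_cong refl avg_transitive_family fin finQ neQ bij transp_X) auto
    also have "\<dots> = avg X h" using X0 fin finite_subset by (intro avg_const) auto
    finally show ?thesis .
  qed
  have avg_Y: "avg Q (\<lambda>q. avg Y0 (\<lambda>k. h (q k))) = avg Y h" for h
  proof -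
    have "avg Q (\<lambda>q. avg Y0 (\<lambda>k. h (q k))) = avg Y0 (\<lambda>k. avg Q (\<lambda>q. h (q k)))"
      by (rule avg_avg_swap)
    also have "\<dots> = avg Y0 (\<lambda>k. avg Y h)"
      using Y0 by (intro avg_cong refl avg_transitive_family fin finQ neQ bij transp_Y) auto
    also have "\<dots> = avg Y h" using Y0 fin finite_subset by (intro avg_const) auto
    finally show ?thesis .
  qed
  have split: "?F p w = avg Q (\<lambda>q. ?H (p \<circ> q) w)" for p w
    using avg_X[of "\<lambda>k. l (p k) w"] avg_Y[of "\<lambda>k. l (p k) w"]
    by (simp only: avg_diff o_apply)
  have "avg ?G (\<lambda>p. MAX w\<in>W. ?F p w) \<le> avg ?G (\<lambda>p. avg Q (\<lambda>q. MAX w\<in>W. ?H (p \<circ> q) w))"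
    unfolding split by (rule avg_mono) (rule MAX_avg_le[OF W])
  also have "\<dots> = avg Q (\<lambda>q. avg ?G (\<lambda>p. MAX w\<in>W. ?H (p \<circ> q) w))"
    by (rule avg_avg_swap)
  also have "\<dots> = avg Q (\<lambda>q. avg ?G (\<lambda>p. MAX w\<in>W. ?H p w))"
    by (rule avg_cong[OF refl], rule avg_permutes_compose) (auto simp: Q_def)
  also have "\<dots> = avg ?G (\<lambda>p. MAX w\<in>W. ?H p w)"
    by (rule avg_const[OF finQ neQ])
  finally show ?thesis .
qed

section \<open>Contraction and symmetrization\<close>

text \<open>A subset encodes a sign vector through its negative positions, so the average over
  \<open>Pow X\<close> is the expectation over independent Rademacher signs on
  \<open>X\<close>.\<close>

definition sg :: "'a set \<Rightarrow> 'a \<Rightarrow> real" where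
  "sg A x = (if x \<in> A then -1 else 1)"

lemma sum_Pow_insert:
  assumes "finite X" "x \<notin> X"
  shows "(\<Sum>A\<in>Pow (insert x X). F A) = (\<Sum>A\<in>Pow X. F A + (F (insert x A) :: real))"
proof -
  have "(\<Sum>A\<in>Pow (insert x X). F A) = (\<Sum>A\<in>Pow X. F A) + (\<Sum>A\<in>insert x ` Pow X. F A)"
    unfolding Pow_insert using assms by (intro sum.union_disjoint) auto
  also have "(\<Sum>A\<in>insert x ` Pow X. F A) = (\<Sum>A\<in>Pow X. F (insert x A))"
    using assms by (intro sum.reindex_cong[of "insert x"] inj_onI) auto
  finally show ?thesis by (simp add: sum.distrib)
qed

lemma sum_sg_insert:
  assumes "finite X" "x \<notin> X" "A \<in> Pow X"
  shows "(\<Sum>y\<in>insert x X. sg A y * f y) = f x + (\<Sum>y\<in>X. sg A y * f y)"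
    and "(\<Sum>y\<in>insert x X. sg (insert x A) y * f y) = - f x + (\<Sum>y\<in>X. sg A y * f y)"
proof -
  have x: "x \<notin> A" using assms by auto
  show "(\<Sum>y\<in>insert x X. sg A y * f y) = f x + (\<Sum>y\<in>X. sg A y * f y)"
    using assms x by (simp add: sg_def)
  have "(\<Sum>y\<in>X. sg (insert x A) y * f y) = (\<Sum>y\<in>X. sg A y * f y)"
    using assms by (intro sum.cong) (auto simp: sg_def)
  then show "(\<Sum>y\<in>insert x X. sg (insert x A) y * f y) = - f x + (\<Sum>y\<in>X. sg A y * f y)"
    using assms by (simp add: sg_def)
qed

text \<open>If \<open>a\<close> and \<open>b\<close> attain the two maxima on the left, the left
  side is at most \<open>g a + g b + \<bar>t a - t b\<bar>\<close>. Using \<open>a\<close> in one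
  maximum on the right and \<open>b\<close> in the other, in the order given by the sign of
  \<open>t a - t b\<close>, reaches this value. The maxima carry no absolute values, so no constant
  is lost.\<close>

lemma contraction_two_point:
  fixes g :: "'w \<Rightarrow> real"
  assumes W: "finite W" "W \<noteq> {}"
    and lip: "\<And>w w'. w \<in> W \<Longrightarrow> w' \<in> W \<Longrightarrow> \<bar>\<phi> w - \<phi> w'\<bar> \<le> \<bar>t w - t w'\<bar>"
  shows "(MAX w\<in>W. g w + \<phi> w) + (MAX w\<in>W. g w - \<phi> w)
    \<le> (MAX w\<in>W. g w + t w) + (MAX w\<in>W. g w - t w)"
proof -
  obtain a where a: "a \<in> W" "(MAX w\<in>W. g w + \<phi> w) = g a + \<phi> a"
    using MAX_attained[OF W] .
  obtain b where b: "b \<in> W" "(MAX w\<in>W. g w - \<phi> w) = g b - \<phi> b"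
    using MAX_attained[OF W] .
  have "g a + t a \<le> (MAX w\<in>W. g w + t w)" "g b + t b \<le> (MAX w\<in>W. g w + t w)"
    "g a - t a \<le> (MAX w\<in>W. g w - t w)" "g b - t b \<le> (MAX w\<in>W. g w - t w)"
    using a b W by (intro MAX_geI[where g="\<lambda>w. g w + t w"] MAX_geI[where g="\<lambda>w. g w - t w"]; simp)+
  with lip[OF a(1) b(1)] show ?thesis unfolding a(2) b(2) by linarith
qed

text \<open>The arbitrary offset \<open>g\<close> makes the induction work: it absorbs the term of
  the new index with either sign while the old indices are contracted, and then the contracted old
  terms while the new index is treated by the two-point case.\<close>

lemma contraction_sum:
  fixes g :: "'w \<Rightarrow> real"
  assumes "finite X" and W: "finite W" "W \<noteq> {}"
    and "\<And>x w w'. x \<in> X \<Longrightarrow> w \<in> W \<Longrightarrow> w' \<in> W \<Longrightarrow> \<bar>\<phi> x w - \<phi> x w'\<bar> \<le> \<bar>t x w - t x w'\<bar>"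
  shows "(\<Sum>A\<in>Pow X. MAX w\<in>W. g w + (\<Sum>x\<in>X. sg A x * \<phi> x w))
    \<le> (\<Sum>A\<in>Pow X. MAX w\<in>W. g w + (\<Sum>x\<in>X. sg A x * t x w))"
  using assms(1,4)
proof (induction X arbitrary: g)
  case empty
  then show ?case by simp
next
  case (insert x X)
  note split = sum_Pow_insert[OF insert.hyps(1,2)] sum_sg_insert[OF insert.hyps(1,2)]
  have IH: "(\<Sum>A\<in>Pow X. MAX w\<in>W. h w + (\<Sum>x\<in>X. sg A x * \<phi> x w))
    \<le> (\<Sum>A\<in>Pow X. MAX w\<in>W. h w + (\<Sum>x\<in>X. sg A x * t x w))" for h
    using insert by blast
  let ?T = "\<lambda>A w. \<Sum>x\<in>X. sg A x * t x w"
  have peel1: "g w + (\<Sum>x\<in>insert x X. sg A x * \<phi> x w) = (g w + \<phi> x w) + (\<Sum>x\<in>X. sg A x * \<phi> x w)"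
    and peel2: "g w + (\<Sum>y\<in>insert x X. sg (insert x A) y * \<phi> y w) = (g w - \<phi> x w) + (\<Sum>x\<in>X. sg A x * \<phi> x w)"
    and peel3: "g w + (\<Sum>x\<in>insert x X. sg A x * t x w) = (g w + ?T A w) + t x w"
    and peel4: "g w + (\<Sum>y\<in>insert x X. sg (insert x A) y * t y w) = (g w + ?T A w) - t x w"
    if "A \<in> Pow X" for A w
    unfolding split(2,3)[OF that] by linarith+
  have "(\<Sum>A\<in>Pow (insert x X). MAX w\<in>W. g w + (\<Sum>x\<in>insert x X. sg A x * \<phi> x w))
    = (\<Sum>A\<in>Pow X. MAX w\<in>W. (g w + \<phi> x w) + (\<Sum>x\<in>X. sg A x * \<phi> x w))
      + (\<Sum>A\<in>Pow X. MAX w\<in>W. (g w - \<phi> x w) + (\<Sum>x\<in>X. sg A x * \<phi> x w))"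
    unfolding split(1) sum.distrib
    by (simp only: peel1 peel2 cong: sum.cong)
  also have "\<dots> \<le> (\<Sum>A\<in>Pow X. MAX w\<in>W. (g w + \<phi> x w) + ?T A w)
      + (\<Sum>A\<in>Pow X. MAX w\<in>W. (g w - \<phi> x w) + ?T A w)"
    by (intro add_mono IH)
  also have "\<dots> = (\<Sum>A\<in>Pow X. (MAX w\<in>W. (g w + ?T A w) + \<phi> x w) + (MAX w\<in>W. (g w + ?T A w) - \<phi> x w))"
    by (simp add: sum.distrib algebra_simps)
  also have "\<dots> \<le> (\<Sum>A\<in>Pow X. (MAX w\<in>W. (g w + ?T A w) + t x w) + (MAX w\<in>W. (g w + ?T A w) - t x w))"
    by (intro sum_mono contraction_two_point W) (use insert.prems in auto)
  also have "\<dots> = (\<Sum>A\<in>Pow (insert x X). MAX w\<in>W. g w + (\<Sum>x\<in>insert x X. sg A x * t x w))"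
    unfolding split(1) by (simp only: peel3 peel4 cong: sum.cong)
  finally show ?case .
qed

text \<open>Independent signs are orthogonal. The induction carries an offset \<open>a\<close> and
  uses \<open>(a + v)\<^sup>2 + (a - v)\<^sup>2 = 2 * (a\<^sup>2 + v\<^sup>2)\<close>.\<close>

lemma sum_Pow_sg_square:
  assumes "finite X"
  shows "(\<Sum>A\<in>Pow X. (\<Sum>x\<in>X. sg A x * v x)\<^sup>2) = 2 ^ card X * (\<Sum>x\<in>X. (v x)\<^sup>2)"
proof -
  have "(\<Sum>A\<in>Pow X. (a + (\<Sum>x\<in>X. sg A x * v x))\<^sup>2) = 2 ^ card X * (a\<^sup>2 + (\<Sum>x\<in>X. (v x)\<^sup>2))" for a
    using assms
  proof (induction X arbitrary: a)
    case empty
    then show ?case by simp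
  next
    case (insert x X)
    note split = sum_Pow_insert[OF insert.hyps(1,2)] sum_sg_insert[OF insert.hyps(1,2)]
    have peel1: "a + (\<Sum>x\<in>insert x X. sg A x * v x) = (a + v x) + (\<Sum>x\<in>X. sg A x * v x)"
      and peel2: "a + (\<Sum>y\<in>insert x X. sg (insert x A) y * v y) = (a - v x) + (\<Sum>x\<in>X. sg A x * v x)"
      if "A \<in> Pow X" for A
      unfolding split(2,3)[OF that] by linarith+
    have "(\<Sum>A\<in>Pow (insert x X). (a + (\<Sum>x\<in>insert x X. sg A x * v x))\<^sup>2)
      = (\<Sum>A\<in>Pow X. ((a + v x) + (\<Sum>x\<in>X. sg A x * v x))\<^sup>2)
        + (\<Sum>A\<in>Pow X. ((a - v x) + (\<Sum>x\<in>X. sg A x * v x))\<^sup>2)"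
      unfolding split(1) sum.distrib
      by (simp only: peel1 peel2 cong: sum.cong)
    also have "\<dots> = 2 ^ card X * ((a + v x)\<^sup>2 + (\<Sum>x\<in>X. (v x)\<^sup>2)) + 2 ^ card X * ((a - v x)\<^sup>2 + (\<Sum>x\<in>X. (v x)\<^sup>2))"
      by (simp only: insert.IH)
    also have "\<dots> = 2 ^ card (insert x X) * (a\<^sup>2 + (\<Sum>x\<in>insert x X. (v x)\<^sup>2))"
      using insert.hyps by (simp add: power2_eq_square algebra_simps)
    finally show ?case .
  qed
  from this[of 0] show ?thesis by simp
qed

text \<open>The norm of a signed sum is bounded by \<open>(norm\<^sup>2 / c + c) / 2\<close> for a free
  parameter \<open>c\<close>, so that only second moments need to be averaged.\<close>

lemma rademacher_linear:
  fixes v :: "'x \<Rightarrow> nat \<Rightarrow> real" and t :: "'x \<Rightarrow> 'w \<Rightarrow> real"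
  assumes X: "finite X" and W: "finite W" "W \<noteq> {}" and c: "c > 0" and "L \<ge> 0"
    and R: "\<And>w. w \<in> W \<Longrightarrow> L2_set (e w) {..<d} \<le> R"
    and t: "\<And>x w. x \<in> X \<Longrightarrow> w \<in> W \<Longrightarrow> t x w = (\<Sum>i<d. e w i * v x i)"
    and lip: "\<And>x w w'. x \<in> X \<Longrightarrow> w \<in> W \<Longrightarrow> w' \<in> W \<Longrightarrow> \<bar>\<phi> x w - \<phi> x w'\<bar> \<le> L * \<bar>t x w - t x w'\<bar>"
  shows "avg (Pow X) (\<lambda>A. MAX w\<in>W. \<Sum>x\<in>X. sg A x * \<phi> x w)
    \<le> L * R * ((\<Sum>x\<in>X. \<Sum>i<d. (v x i)\<^sup>2) / c + c) / 2"
proof -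
  obtain w0 where "w0 \<in> W" using W by auto
  have R0: "R \<ge> 0" using R[OF \<open>w0 \<in> W\<close>] by (meson L2_set_nonneg order.trans)
  let ?z = "\<lambda>A i. \<Sum>x\<in>X. sg A x * v x i"
  have card: "card (Pow X) = 2 ^ card X" using X by (simp add: card_Pow)
  have "avg (Pow X) (\<lambda>A. MAX w\<in>W. \<Sum>x\<in>X. sg A x * \<phi> x w)
      \<le> avg (Pow X) (\<lambda>A. MAX w\<in>W. \<Sum>x\<in>X. sg A x * (L * t x w))"
    unfolding avg_def using contraction_sum[OF X W, of \<phi> "\<lambda>x w. L * t x w" "\<lambda>_. 0"] lip \<open>L \<ge> 0\<close>
    by (intro divide_right_mono) (auto simp: abs_mult right_diff_distrib[symmetric])
  also have "\<dots> \<le> avg (Pow X) (\<lambda>A. L * R / 2 * ((1 / c) * (\<Sum>i<d. (?z A i)\<^sup>2) + c))"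
  proof (intro avg_mono MAX_leI W)
    fix A w assume w: "w \<in> W"
    have "(\<Sum>x\<in>X. sg A x * (L * t x w)) = L * (\<Sum>x\<in>X. \<Sum>i<d. e w i * (sg A x * v x i))"
      using w by (simp add: t sum_distrib_left mult_ac)
    also have "\<dots> = L * (\<Sum>i<d. e w i * ?z A i)"
      by (subst sum.swap) (simp add: sum_distrib_left)
    also have "\<dots> \<le> L * (R * L2_set (?z A) {..<d})"
    proof (rule mult_left_mono[OF _ \<open>L \<ge> 0\<close>])
      have "(\<Sum>i<d. e w i * ?z A i) \<le> (\<Sum>i<d. \<bar>e w i\<bar> * \<bar>?z A i\<bar>)"
        by (intro sum_mono) (simp add: abs_mult[symmetric])
      also have "\<dots> \<le> L2_set (e w) {..<d} * L2_set (?z A) {..<d}" by (rule L2_set_mult_ineq)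
      also have "\<dots> \<le> R * L2_set (?z A) {..<d}"
        by (intro mult_right_mono R w L2_set_nonneg)
      finally show "(\<Sum>i<d. e w i * ?z A i) \<le> R * L2_set (?z A) {..<d}" .
    qed
    also have "\<dots> = L * R * L2_set (?z A) {..<d}" by simp
    also have "\<dots> \<le> L * R * (((\<Sum>i<d. (?z A i)\<^sup>2) / c + c) / 2)"
    proof (rule mult_left_mono)
      let ?n = "L2_set (?z A) {..<d}"
      have "?n\<^sup>2 = (\<Sum>i<d. (?z A i)\<^sup>2)" by (simp add: L2_set_def sum_nonneg)
      moreover have "0 \<le> (?n - c)\<^sup>2 / c" using c by simp
      ultimately show "?n \<le> ((\<Sum>i<d. (?z A i)\<^sup>2) / c + c) / 2"
        using c by (simp add: power2_diff field_simps power2_eq_square)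
    qed (use R0 \<open>L \<ge> 0\<close> in simp)
    finally show "(\<Sum>x\<in>X. sg A x * (L * t x w)) \<le> L * R / 2 * ((1 / c) * (\<Sum>i<d. (?z A i)\<^sup>2) + c)"
      by simp
  qed
  also have "\<dots> = L * R / 2 * (avg (Pow X) (\<lambda>A. (1 / c) * (\<Sum>i<d. (?z A i)\<^sup>2)) + c)"
    using X by (simp only: avg_cmult avg_add) (simp add: Pow_not_empty)
  also have "avg (Pow X) (\<lambda>A. (1 / c) * (\<Sum>i<d. (?z A i)\<^sup>2)) = (1 / c) * (\<Sum>i<d. \<Sum>x\<in>X. (v x i)\<^sup>2)"
    by (simp only: avg_cmult avg_sum_swap) (simp add: avg_def sum_Pow_sg_square[OF X] card)
  also have "(\<Sum>i<d. \<Sum>x\<in>X. (v x i)\<^sup>2) = (\<Sum>x\<in>X. \<Sum>i<d. (v x i)\<^sup>2)" by (rule sum.swap)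
  finally show ?thesis by simp
qed

text \<open>For a matching \<open>b\<close> of \<open>X\<close> with a disjoint set, this is the
  product of the disjoint transpositions of \<open>k\<close> and \<open>b k\<close> for
  \<open>k\<close> in \<open>A\<close>; \<open>inv_into X b\<close> leads back from a partner to its
  element.\<close>

definition swaps :: "('a \<Rightarrow> 'a) \<Rightarrow> 'a set \<Rightarrow> 'a set \<Rightarrow> 'a \<Rightarrow> 'a" where
  "swaps b X A k = (if k \<in> A then b k else if k \<in> b ` A then inv_into X b k else k)"

lemma swaps_permutes:
  assumes b: "bij_betw b X Y" and XY: "X \<inter> Y = {}" "X \<subseteq> P" "Y \<subseteq> P" and A: "A \<subseteq> X"
  shows "swaps b X A permutes P"
proof -
  have inj: "inj_on b X" and im: "b ` X = Y" using b by (auto simp: bij_betw_def)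
  have bA: "b k \<in> Y" if "k \<in> A" for k using that A im by auto
  have invol: "swaps b X A (swaps b X A k) = k" for k
  proof (cases "k \<in> A")
    case True
    then show ?thesis using bA[OF True] XY A inj by (auto simp: swaps_def)
  next
    case False
    then show ?thesis
      using A inj by (cases "k \<in> b ` A") (auto simp: swaps_def inv_into_f_f subset_iff)
  qed
  have "bij_betw (swaps b X A) P P"
  proof (rule bij_betwI[where g="swaps b X A"])
    show "swaps b X A \<in> P \<rightarrow> P" 
    proof
      fix k assume "k \<in> P"
      then show "swaps b X A k \<in> P"
        using bA XY A inj by (auto simp: swaps_def inv_into_f_f subset_iff)
    qed
    then show "swaps b X A \<in> P \<rightarrow> P" .
  qed (rule invol)+
  moreover have "swaps b X A k = k" if "k \<notin> P" for k
    using that A XY bA unfolding swaps_def by (smt (verit) image_iff subset_iff)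
  ultimately show ?thesis by (rule bij_imp_permutes)
qed

lemma swaps_apply:
  assumes b: "bij_betw b X Y" and XY: "X \<inter> Y = {}" and A: "A \<subseteq> X" and k: "k \<in> X"
  shows "swaps b X A k = (if k \<in> A then b k else k)"
    and "swaps b X A (b k) = (if k \<in> A then k else b k)"
proof -
  have inj: "inj_on b X" and im: "b ` X = Y" using b by (auto simp: bij_betw_def)
  have "k \<notin> b ` A" "b k \<notin> A" using k im A XY by auto
  then show "swaps b X A k = (if k \<in> A then b k else k)"
    and "swaps b X A (b k) = (if k \<in> A then k else b k)"
    using inj k A by (auto simp: swaps_def inv_into_f_f inj_on_image_mem_iff)
qed

text \<open>Swapping matched elements of \<open>X\<close> and \<open>Y\<close> leaves the average over all permutations
  unchanged and introduces independent signs.\<close>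

lemma symmetrization:
  fixes l :: "'k \<Rightarrow> 'w \<Rightarrow> real"
  assumes P: "finite P" and XY: "X \<subseteq> P" "Y \<subseteq> P" "X \<inter> Y = {}"
    and b: "bij_betw b X Y" and W: "finite W" "W \<noteq> {}"
  shows "avg {p. p permutes P} (\<lambda>p. MAX w\<in>W. avg X (\<lambda>k. l (p k) w) - avg Y (\<lambda>k. l (p k) w))
    \<le> avg {p. p permutes P} (\<lambda>p.
          avg (Pow X) (\<lambda>A. MAX w\<in>W. \<Sum>k\<in>X. sg A k * l (p k) w)
        + avg (Pow X) (\<lambda>A. MAX w\<in>W. \<Sum>k\<in>X. sg A k * (- l (p (b k)) w))) / real (card X)"
proof -
  let ?G = "{p. p permutes P}"
  let ?F = "\<lambda>p w. avg X (\<lambda>k. l (p k) w) - avg Y (\<lambda>k. l (p k) w)"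
  let ?M = "\<lambda>p A. MAX w\<in>W. \<Sum>k\<in>X. sg A k * l (p k) w"
  let ?N = "\<lambda>p A. MAX w\<in>W. \<Sum>k\<in>X. sg A k * (- l (p (b k)) w)"
  have finX: "finite X" using P XY by (auto intro: finite_subset)
  have F: "?F p w = (\<Sum>k\<in>X. l (p k) w - l (p (b k)) w) / real (card X)" for p w
    unfolding avg_reindex[OF b, symmetric] by (simp add: avg_def sum_subtractf diff_divide_distrib)
  have le: "(MAX w\<in>W. ?F (p \<circ> swaps b X A) w) \<le> (?M p A + ?N p A) / real (card X)"
    if A: "A \<subseteq> X" for p A
  proof (rule MAX_leI[OF W])
    fix w assume w: "w \<in> W"
    have "(\<Sum>k\<in>X. l (p (swaps b X A k)) w - l (p (swaps b X A (b k))) w)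
      = (\<Sum>k\<in>X. sg A k * l (p k) w + sg A k * (- l (p (b k)) w))"
      by (intro sum.cong refl) (simp add: swaps_apply[OF b XY(3) A] sg_def)
    \<comment> \<open>Giving the signed losses of the two matched positions a maximum each is the
      origin of the factor 2 in the complexity term.\<close>
    also have "\<dots> \<le> ?M p A + ?N p A"
      unfolding sum.distrib using W w
      by (intro add_mono MAX_geI[where g="\<lambda>w. \<Sum>k\<in>X. sg A k * l (p k) w"]
          MAX_geI[where g="\<lambda>w. \<Sum>k\<in>X. sg A k * (- l (p (b k)) w)"])
    finally show "?F (p \<circ> swaps b X A) w \<le> (?M p A + ?N p A) / real (card X)"
      unfolding F by (simp add: divide_right_mono)
  qed
  have "avg ?G (\<lambda>p. MAX w\<in>W. ?F p w)
    = avg (Pow X) (\<lambda>A. avg ?G (\<lambda>p. MAX w\<in>W. ?F p w))"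
    using finX by (intro avg_const[symmetric]) auto
  also have "\<dots> = avg (Pow X) (\<lambda>A. avg ?G (\<lambda>p. MAX w\<in>W. ?F (p \<circ> swaps b X A) w))"
    by (intro avg_cong refl avg_permutes_compose[symmetric] swaps_permutes[OF b]) (use XY in auto)
  also have "\<dots> = avg ?G (\<lambda>p. avg (Pow X) (\<lambda>A. MAX w\<in>W. ?F (p \<circ> swaps b X A) w))"
    by (rule avg_avg_swap)
  also have "\<dots> \<le> avg ?G (\<lambda>p. avg (Pow X) (\<lambda>A. (?M p A + ?N p A) / real (card X)))"
    by (intro avg_mono le) auto
  also have "\<dots> = avg ?G (\<lambda>p. avg (Pow X) (?M p) + avg (Pow X) (?N p)) / real (card X)"
    by (simp only: avg_divide avg_add)
  finally show ?thesis .
qed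

text \<open>Here \<open>e w\<close> and \<open>v k\<close> are the coordinates of a weight vector
  and of a feature vector. Under a random permutation the element at any fixed position is uniform
  on \<open>P\<close>, so only the mean \<open>D\<close> of the squared feature norms matters, not
  their maximum.\<close>

lemma avg_MAX_gap_bound:
  fixes l :: "'k \<Rightarrow> 'w \<Rightarrow> real" and v :: "'k \<Rightarrow> nat \<Rightarrow> real"
  assumes P: "finite P" and S: "S \<subseteq> P" and r: "0 < r" "r \<le> card S" "r \<le> card (P - S)"
    and W: "finite W" "W \<noteq> {}" and "L \<ge> 0" and D: "D > 0"
    and R: "\<And>w. w \<in> W \<Longrightarrow> L2_set (e w) {..<d} \<le> R"
    and lip: "\<And>k w w'. k \<in> P \<Longrightarrow> w \<in> W \<Longrightarrow> w' \<in> W \<Longrightarrow>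
      \<bar>l k w - l k w'\<bar> \<le> L * \<bar>(\<Sum>i<d. e w i * v k i) - (\<Sum>i<d. e w' i * v k i)\<bar>"
    and avg_v: "avg P (\<lambda>k. \<Sum>i<d. (v k i)\<^sup>2) \<le> D"
  shows "avg {p. p permutes P} (\<lambda>p. MAX w\<in>W. avg (P - p ` S) (\<lambda>k. l k w) - avg (p ` S) (\<lambda>k. l k w))
    \<le> 2 * L * R * sqrt (D / r)"
proof -
  let ?G = "{p. p permutes P}"
  have fin: "finite S" "finite (P - S)" using P S finite_subset by auto
  obtain Y where Y: "Y \<subseteq> S" "card Y = r" using r(2) by (meson obtain_subset_with_card_n)
  obtain X where X: "X \<subseteq> P - S" "card X = r" using r(3) by (meson obtain_subset_with_card_n)
  have finXY: "finite X" "finite Y" using X Y fin by (auto intro: finite_subset)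
  have ne: "X \<noteq> {}" "Y \<noteq> {}" using X Y r by auto
  obtain b where b: "bij_betw b X Y"
    using finite_same_card_bij[OF finXY] X Y by auto
  have bX: "b k \<in> P" if "k \<in> X" for k using b that Y S by (auto simp: bij_betw_def)
  have XP: "k \<in> P" if "k \<in> X" for k using that X by auto
  obtain w0 where "w0 \<in> W" using W by auto
  have R0: "R \<ge> 0" using R[OF \<open>w0 \<in> W\<close>] by (meson L2_set_nonneg order.trans)
  \<comment> \<open>The expected squared norm of a signed sum of \<open>r\<close> features is at
    most \<open>r * D\<close>; this \<open>c\<close> is its square root and balances the two terms
    of \<open>(r * D / c + c) / 2\<close>.\<close>
  define c where "c = sqrt (D * r)"
  have c: "c > 0" using D r by (simp add: c_def)
  have cc: "c * c = D * r" using D r by (simp add: c_def)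
  let ?V = "\<lambda>k. \<Sum>i<d. (v k i)\<^sup>2"
  have Gavg: "avg ?G (\<lambda>p. \<Sum>k\<in>X. ?V (p (h k))) \<le> r * D" if "\<And>k. k \<in> X \<Longrightarrow> h k \<in> P" for h
  proof -
    have "avg ?G (\<lambda>p. \<Sum>k\<in>X. ?V (p (h k))) = (\<Sum>k\<in>X. avg ?G (\<lambda>p. ?V (p (h k))))"
      by (rule avg_sum_swap)
    also have "\<dots> = (\<Sum>k\<in>X. avg P ?V)"
      by (intro sum.cong refl avg_permutes_apply[OF P, of _ ?V] that)
    also have "\<dots> \<le> r * D" using avg_v X by (simp add: mult_left_mono)
    finally show ?thesis .
  qed
  have "avg ?G (\<lambda>p. MAX w\<in>W. avg (P - p ` S) (\<lambda>k. l k w) - avg (p ` S) (\<lambda>k. l k w))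
    = avg ?G (\<lambda>p. MAX w\<in>W. avg (P - S) (\<lambda>k. l (p k) w) - avg S (\<lambda>k. l (p k) w))"
  proof (rule avg_cong[OF refl])
    fix p assume "p \<in> ?G"
    then have p: "p permutes P" by simp
    have inj: "inj_on p A" for A using permutes_inj_on[OF p] .
    have "P - p ` S = p ` (P - S)"
      using permutes_image[OF p] permutes_inj[OF p] by (simp add: image_set_diff)
    then show "(MAX w\<in>W. avg (P - p ` S) (\<lambda>k. l k w) - avg (p ` S) (\<lambda>k. l k w))
      = (MAX w\<in>W. avg (P - S) (\<lambda>k. l (p k) w) - avg S (\<lambda>k. l (p k) w))"
      by (simp add: avg_image[OF inj])
  qed
  also have "\<dots> \<le> avg ?G (\<lambda>p. MAX w\<in>W. avg X (\<lambda>k. l (p k) w) - avg Y (\<lambda>k. l (p k) w))"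
    by (rule avg_MAX_shrink[OF P _ S _ X(1) ne(1) Y(1) ne(2) W]) auto
  also have "\<dots> \<le> avg ?G (\<lambda>p.
          avg (Pow X) (\<lambda>A. MAX w\<in>W. \<Sum>k\<in>X. sg A k * l (p k) w)
        + avg (Pow X) (\<lambda>A. MAX w\<in>W. \<Sum>k\<in>X. sg A k * (- l (p (b k)) w))) / real (card X)"
    by (rule symmetrization[OF P _ _ _ b W]) (use X Y S in auto)
  also have "\<dots> \<le> avg ?G (\<lambda>p. L * R * ((\<Sum>k\<in>X. ?V (p k)) / c + c) / 2
        + L * R * ((\<Sum>k\<in>X. ?V (p (b k))) / c + c) / 2) / real (card X)"
  proof (intro divide_right_mono avg_mono add_mono)
    fix p assume "p \<in> ?G"
    then have pP: "p k \<in> P" if "k \<in> P" for k using that by (simp add: permutes_in_image)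
    show "avg (Pow X) (\<lambda>A. MAX w\<in>W. \<Sum>k\<in>X. sg A k * l (p k) w)
      \<le> L * R * ((\<Sum>k\<in>X. ?V (p k)) / c + c) / 2"
      by (rule rademacher_linear[OF finXY(1) W c \<open>L \<ge> 0\<close> R, where t="\<lambda>k w. \<Sum>i<d. e w i * v (p k) i"])
        (auto intro: lip pP XP)
    show "avg (Pow X) (\<lambda>A. MAX w\<in>W. \<Sum>k\<in>X. sg A k * (- l (p (b k)) w))
      \<le> L * R * ((\<Sum>k\<in>X. ?V (p (b k))) / c + c) / 2"
    proof (rule rademacher_linear[OF finXY(1) W c \<open>L \<ge> 0\<close> R, where t="\<lambda>k w. \<Sum>i<d. e w i * v (p (b k)) i"])
      fix k w w' assume "k \<in> X" "w \<in> W" "w' \<in> W"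
      with lip[OF pP[OF bX]] show "\<bar>- l (p (b k)) w - - l (p (b k)) w'\<bar>
        \<le> L * \<bar>(\<Sum>i<d. e w i * v (p (b k)) i) - (\<Sum>i<d. e w' i * v (p (b k)) i)\<bar>"
        by (simp add: abs_minus_commute)
    qed auto
  qed auto
  also have "avg ?G (\<lambda>p. L * R * ((\<Sum>k\<in>X. ?V (p k)) / c + c) / 2
        + L * R * ((\<Sum>k\<in>X. ?V (p (b k))) / c + c) / 2)
      = avg ?G (\<lambda>p. L * R / (2 * c) * ((\<Sum>k\<in>X. ?V (p k)) + (\<Sum>k\<in>X. ?V (p (b k)))) + L * R * c)"
    by (rule avg_cong) (use c in \<open>simp_all add: field_simps\<close>)
  also have "\<dots> = L * R / (2 * c) * (avg ?G (\<lambda>p. \<Sum>k\<in>X. ?V (p k)) + avg ?G (\<lambda>p. \<Sum>k\<in>X. ?V (p (b k)))) + L * R * c"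
    using finite_permutations[OF P] by (simp only: avg_add avg_cmult avg_const permutations_nonempty not_False_eq_True)
  also have "\<dots> / real (card X) \<le> (L * R / (2 * c) * (r * D + r * D) + L * R * c) / real (card X)"
    using \<open>L \<ge> 0\<close> R0 c bX XP
    by (intro divide_right_mono add_mono mult_left_mono Gavg Gavg[of "\<lambda>k. k", simplified]) auto
  also have "\<dots> = 2 * L * R * (c / r)"
  proof -
    have "L * R / (2 * c) * (r * D + r * D) = L * R / c * (c * c)" by (simp add: cc)
    also have "\<dots> = L * R * c" using c by simp
    finally show ?thesis using X by simp
  qed
  also have "c / r = sqrt (D / r)"
  proof -
    have "sqrt (D / r) = sqrt (D * r / (real r)\<^sup>2)" using r by (simp add: power2_eq_square)
    then show ?thesis using r by (simp add: c_def real_sqrt_divide)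
  qed
  finally show ?thesis .
qed

section \<open>Concentration for sampling without replacement\<close>

text \<open>For a centered variable the linear term averages out, which leaves a sub-Gaussian bound
  on the exponential moment. Compared with the sharp Hoeffding lemma this loses a factor 8 in the
  exponent, which only affects the constant of the deviation term.\<close>

lemma exp_le_add_exp_square: "exp x \<le> x + exp (x\<^sup>2)" for x :: real
proof -
  have sq: "1 + x\<^sup>2 \<le> exp (x\<^sup>2)" by (rule exp_ge_add_one_self)
  consider "x < - 1" | "-1 \<le> x" "x \<le> 0" | "0 \<le> x" "x \<le> 1" | "1 < x" by linarith
  then show ?thesis
  proof cases
    case 1
    then have "exp x < 1" by simp
    moreover have "- x \<le> x\<^sup>2" using 1 mult_left_mono[of 1 "- x" "- x"] by (simp add: power2_eq_square)
    ultimately show ?thesis using sq by linarith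
  next
    case 2
    \<comment> \<open>For negative arguments \<open>exp x \<le> 1 + x + x\<^sup>2\<close> comes from
      inverting a Taylor lower bound for \<open>exp (- x)\<close>: the product of the two quadratic
      polynomials is at least 1 on this interval.\<close>
    have "1 + (-x) + (-x)\<^sup>2 / 2 \<le> exp (- x)" by (rule exp_lower_Taylor_quadratic) (use 2 in simp)
    then have "exp x * (1 - x + x\<^sup>2 / 2) \<le> exp x * exp (- x)" by (intro mult_left_mono) auto
    then have le: "exp x * (1 - x + x\<^sup>2 / 2) \<le> 1" by (simp add: exp_minus)
    have "(1 + x + x\<^sup>2) * (1 - x + x\<^sup>2 / 2) = 1 + x\<^sup>2 * (1 - x + x\<^sup>2) / 2"
      by (simp add: power2_eq_square field_simps)
    also have "\<dots> \<ge> 1" using 2 by simp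
    finally have "exp x * (1 - x + x\<^sup>2 / 2) \<le> (1 + x + x\<^sup>2) * (1 - x + x\<^sup>2 / 2)" using le by linarith
    moreover have "1 - x + x\<^sup>2 / 2 > 0" using 2 by (simp add: add_pos_nonneg)
    ultimately have "exp x \<le> 1 + x + x\<^sup>2" by (simp only: mult_le_cancel_right_pos)
    then show ?thesis using sq by linarith
  next
    case 3
    then have "exp x \<le> 1 + x + x\<^sup>2" by (rule exp_bound)
    then show ?thesis using sq by linarith
  next
    case 4
    then have "exp x \<le> exp (x\<^sup>2)" by (simp add: power2_eq_square)
    then show ?thesis using 4 by linarith
  qed
qed

lemma avg_exp_centered:
  assumes "finite A" "A \<noteq> {}" and \<mu>: "\<And>x y. x \<in> A \<Longrightarrow> y \<in> A \<Longrightarrow> \<bar>\<mu> x - \<mu> y\<bar> \<le> \<beta>"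
  shows "avg A (\<lambda>x. exp (s * (\<mu> x - avg A \<mu>))) \<le> exp (s\<^sup>2 * \<beta>\<^sup>2)"
proof -
  have "avg A (\<lambda>x. exp (s * (\<mu> x - avg A \<mu>))) \<le> avg A (\<lambda>x. s * (\<mu> x - avg A \<mu>) + exp (s\<^sup>2 * \<beta>\<^sup>2))"
  proof (rule avg_mono)
    fix x assume x: "x \<in> A"
    have "\<bar>avg A (\<lambda>_. \<mu> x) - avg A \<mu>\<bar> \<le> \<beta>"
      by (rule avg_abs_diff_le[OF assms(1,2)]) (use \<mu> x in auto)
    then have "\<bar>\<mu> x - avg A \<mu>\<bar> \<le> \<beta>" using assms by simp
    then have "(\<mu> x - avg A \<mu>)\<^sup>2 \<le> \<beta>\<^sup>2" by (metis abs_ge_zero power2_abs power_mono)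
    then have "(s * (\<mu> x - avg A \<mu>))\<^sup>2 \<le> s\<^sup>2 * \<beta>\<^sup>2" by (simp add: power_mult_distrib mult_left_mono)
    then show "exp (s * (\<mu> x - avg A \<mu>)) \<le> s * (\<mu> x - avg A \<mu>) + exp (s\<^sup>2 * \<beta>\<^sup>2)"
      using exp_le_add_exp_square[of "s * (\<mu> x - avg A \<mu>)"] by (smt (verit) exp_le_cancel_iff)
  qed
  also have "\<dots> = exp (s\<^sup>2 * \<beta>\<^sup>2)"
    using assms(1,2) by (simp only: avg_add avg_cmult avg_diff avg_const) simp
  finally show ?thesis .
qed

text \<open>Drawing a uniform set of \<open>Suc m\<close> elements amounts to drawing one element
  and then a uniform \<open>m\<close>-subset of the rest. The proof counts pairs of a set and a
  distinguished member, where each set occurs \<open>Suc m\<close> times.\<close>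

lemma avg_subsets_Suc:
  assumes P: "finite P" and m: "Suc m \<le> card P"
  shows "avg {S. S \<subseteq> P \<and> card S = Suc m} F
    = avg P (\<lambda>x. avg {S. S \<subseteq> P - {x} \<and> card S = m} (\<lambda>S. F (insert x S)))"
proof -
  let ?C = "{S. S \<subseteq> P \<and> card S = Suc m}" and ?D = "\<lambda>x. {S. S \<subseteq> P - {x} \<and> card S = m}"
  have count: "(\<Sum>x\<in>P. \<Sum>S\<in>?D x. H (insert x S)) = real (Suc m) * (\<Sum>S\<in>?C. H S)"
    for H :: "'a set \<Rightarrow> real"
  proof -
    have "(\<Sum>x\<in>P. \<Sum>S\<in>?D x. H (insert x S)) = (\<Sum>(x, S)\<in>Sigma P ?D. H (insert x S))"
      using P by (intro sum.Sigma) (auto intro: finite_card_subsets)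
    also have "\<dots> = (\<Sum>(S, x)\<in>Sigma ?C (\<lambda>S. S). H S)"
    proof (rule sum.reindex_bij_witness[where i="\<lambda>(S, x). (x, S - {x})" and j="\<lambda>(x, S). (insert x S, x)"])
      fix a assume "a \<in> Sigma P ?D"
      then obtain x S where a: "a = (x, S)" "x \<in> P" "S \<subseteq> P - {x}" "card S = m" by auto
      then have "finite S" "x \<notin> S" using P by (auto intro: finite_subset)
      with a show "(case (case a of (x, S) \<Rightarrow> (insert x S, x)) of (S, x) \<Rightarrow> (x, S - {x})) = a"
        and "(case a of (x, S) \<Rightarrow> (insert x S, x)) \<in> Sigma ?C (\<lambda>S. S)"
        and "(case (case a of (x, S) \<Rightarrow> (insert x S, x)) of (S, x) \<Rightarrow> H S) = (case a of (x, S) \<Rightarrow> H (insert x S))"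
        by auto
    next
      fix b assume "b \<in> Sigma ?C (\<lambda>S. S)"
      then obtain S x where b: "b = (S, x)" "S \<subseteq> P" "card S = Suc m" "x \<in> S" by auto
      then have "finite S" using P by (auto intro: finite_subset)
      with b show "(case (case b of (S, x) \<Rightarrow> (x, S - {x})) of (x, S) \<Rightarrow> (insert x S, x)) = b"
        and "(case b of (S, x) \<Rightarrow> (x, S - {x})) \<in> Sigma P ?D"
        by auto
    qed
    also have "\<dots> = (\<Sum>S\<in>?C. \<Sum>x\<in>S. H S)"
      using P by (intro sum.Sigma[symmetric] ballI finite_card_subsets) (auto intro: finite_subset)
    also have "\<dots> = real (Suc m) * (\<Sum>S\<in>?C. H S)" by (simp add: sum_distrib_left)
    finally show ?thesis .
  qed
  define c where "c = (card P - 1) choose m"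
  have card_D: "card (?D x) = c" if "x \<in> P" for x
    using that P n_subsets[of "P - {x}" m] by (simp add: c_def)
  have "real (card P) * c = real (Suc m) * card ?C"
    using count[of "\<lambda>_. 1"] card_D by simp
  moreover have "avg P (\<lambda>x. avg (?D x) (\<lambda>S. F (insert x S)))
    = (\<Sum>x\<in>P. \<Sum>S\<in>?D x. F (insert x S)) / (real (card P) * c)"
    by (simp add: avg_def card_D sum_divide_distrib[symmetric] cong: sum.cong)
  ultimately show ?thesis by (simp add: count avg_def)
qed

text \<open>This is the bounded difference argument with the elements of \<open>S\<close> revealed
  one at a time. Given the first element \<open>x\<close>, the induction hypothesis controls the
  deviation from the conditional mean \<open>\<mu> x\<close>, and the deviation of
  \<open>\<mu> x\<close> from the overall mean contributes one further factor.\<close>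

lemma avg_subsets_exp_le:
  fixes F :: "'a set \<Rightarrow> real"
  assumes "finite P" "m \<le> card P" "\<beta> \<ge> 0"
    and "\<And>S x y. S \<subseteq> P \<Longrightarrow> card S = m \<Longrightarrow> x \<in> S \<Longrightarrow> y \<in> P - S \<Longrightarrow> \<bar>F S - F (insert y (S - {x}))\<bar> \<le> \<beta>"
  shows "avg {S. S \<subseteq> P \<and> card S = m} (\<lambda>S. exp (s * (F S - avg {S. S \<subseteq> P \<and> card S = m} F)))
    \<le> exp (m * (s\<^sup>2 * \<beta>\<^sup>2))"
  using assms
proof (induction m arbitrary: P F)
  case 0
  then have "{S. S \<subseteq> P \<and> card S = 0} = {{}}" by (auto dest: finite_subset)
  then show ?case by (simp add: avg_def)
next
  case (Suc m)
  let ?D = "\<lambda>x. {S. S \<subseteq> P - {x} \<and> card S = m}"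
  define \<mu> where "\<mu> x = avg (?D x) (\<lambda>S. F (insert x S))" for x
  have fin: "finite (?D x)" for x using Suc.prems by (intro finite_card_subsets) auto
  have ne: "?D x \<noteq> {}" if "x \<in> P" for x
    using Suc.prems that by (intro card_subsets_nonempty) auto
  have finP: "finite P" and neP: "P \<noteq> {}" using Suc.prems by auto
  have mean: "avg {S. S \<subseteq> P \<and> card S = Suc m} F = avg P \<mu>"
    unfolding \<mu>_def by (rule avg_subsets_Suc[OF Suc.prems(1,2)])
  have finS: "finite S" if "S \<subseteq> P - {x}" for S x using that finP by (meson finite_Diff finite_subset)
  have inner: "avg (?D x) (\<lambda>S. exp (s * (F (insert x S) - \<mu> x))) \<le> exp (m * (s\<^sup>2 * \<beta>\<^sup>2))"
    if x: "x \<in> P" for x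
    unfolding \<mu>_def
  proof (rule Suc.IH)
    fix S u v assume S: "S \<subseteq> P - {x}" "card S = m" "u \<in> S" "v \<in> P - {x} - S"
    then have "\<bar>F (insert x S) - F (insert v (insert x S - {u}))\<bar> \<le> \<beta>"
      using x finS[OF S(1)] by (intro Suc.prems(4)) (auto simp: card_insert_if)
    moreover have "insert v (insert x S - {u}) = insert x (insert v (S - {u}))" using S by auto
    ultimately show "\<bar>F (insert x S) - F (insert x (insert v (S - {u})))\<bar> \<le> \<beta>" by simp
  qed (use Suc.prems x in auto)
  \<comment> \<open>The draws that start with \<open>x\<close> and with \<open>y\<close> are coupled
    by the transposition of \<open>x\<close> and \<open>y\<close>. Coupled sets coincide if the
    first one contains \<open>y\<close>, and otherwise differ by the exchange of \<open>x\<close>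
    for \<open>y\<close>.\<close>
  have \<mu>: "\<bar>\<mu> x - \<mu> y\<bar> \<le> \<beta>" if xy: "x \<in> P" "y \<in> P" for x y
  proof (cases "x = y")
    case False
    let ?t = "Transposition.transpose x y"
    have "bij_betw ?t (P - {x}) (P - {y})"
      by (rule bij_betwI[where g="?t"]) (use xy False in \<open>auto simp: Transposition.transpose_def\<close>)
    from avg_reindex[OF bij_betw_card_subsets[OF _ this], of m "\<lambda>S. F (insert y S)"]
    have "\<mu> y = avg (?D x) (\<lambda>S. F (insert y (?t ` S)))" unfolding \<mu>_def using finP by simp
    moreover have "\<bar>avg (?D x) (\<lambda>S. F (insert x S)) - avg (?D x) (\<lambda>S. F (insert y (?t ` S)))\<bar> \<le> \<beta>"
    proof (rule avg_abs_diff_le[OF fin ne[OF xy(1)]])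
      fix S assume "S \<in> ?D x"
      then have S: "S \<subseteq> P - {x}" "card S = m" by auto
      show "\<bar>F (insert x S) - F (insert y (?t ` S))\<bar> \<le> \<beta>"
      proof (cases "y \<in> S")
        case True
        have "insert y (?t ` S) = insert x S"
          using S True False by (auto simp: Transposition.transpose_def image_iff split: if_splits)
        then show ?thesis using Suc.prems by simp
      next
        case False
        have "?t ` S = S"
          using S False by (subst transpose_image_eq) auto
        then have "insert y (?t ` S) = insert y (insert x S - {x})" using S by auto
        moreover have "x \<notin> S" using S by auto
        ultimately show ?thesis
          using Suc.prems(4)[of "insert x S" x y] S xy \<open>x \<noteq> y\<close> False finS[OF S(1)]
          by (auto simp: card_insert_if)
      qed
    qed
    ultimately show ?thesis by (simp add: \<mu>_def)
  qed (use Suc.prems in simp)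
  have "avg {S. S \<subseteq> P \<and> card S = Suc m} (\<lambda>S. exp (s * (F S - avg {S. S \<subseteq> P \<and> card S = Suc m} F)))
    = avg P (\<lambda>x. avg (?D x) (\<lambda>S. exp (s * (F (insert x S) - avg P \<mu>))))"
    unfolding mean by (rule avg_subsets_Suc[OF Suc.prems(1,2)])
  also have "\<dots> = avg P (\<lambda>x. exp (s * (\<mu> x - avg P \<mu>)) * avg (?D x) (\<lambda>S. exp (s * (F (insert x S) - \<mu> x))))"
    unfolding avg_cmult[symmetric] exp_add[symmetric] by (simp add: algebra_simps)
  also have "\<dots> \<le> avg P (\<lambda>x. exp (m * (s\<^sup>2 * \<beta>\<^sup>2)) * exp (s * (\<mu> x - avg P \<mu>)))"
    by (intro avg_mono, subst mult.commute, intro mult_right_mono inner) auto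
  also have "\<dots> \<le> exp (m * (s\<^sup>2 * \<beta>\<^sup>2)) * exp (s\<^sup>2 * \<beta>\<^sup>2)"
    unfolding avg_cmult by (intro mult_left_mono avg_exp_centered finP neP \<mu>) auto
  also have "\<dots> = exp (Suc m * (s\<^sup>2 * \<beta>\<^sup>2))"
    by (simp add: exp_add[symmetric] algebra_simps)
  finally show ?case .
qed

lemma subsets_concentration:
  fixes F :: "'a set \<Rightarrow> real"
  assumes P: "finite P" and m: "0 < m" "m \<le> card P" and "\<beta> > 0" "K > 0"
    and bd: "\<And>S x y. S \<subseteq> P \<Longrightarrow> card S = m \<Longrightarrow> x \<in> S \<Longrightarrow> y \<in> P - S \<Longrightarrow> \<bar>F S - F (insert y (S - {x}))\<bar> \<le> \<beta>"
  shows "measure_pmf.prob (pmf_of_set {S. S \<subseteq> P \<and> card S = m})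
      {S. F S > avg {S. S \<subseteq> P \<and> card S = m} F + 2 * \<beta> * sqrt (m * K)} \<le> exp (- K)"
proof -
  let ?C = "{S. S \<subseteq> P \<and> card S = m}"
  let ?a = "avg ?C F" and ?t = "2 * \<beta> * sqrt (m * K)"
  \<comment> \<open>With this \<open>s\<close> the exponent of the moment bound is \<open>K\<close>
    and the threshold contributes \<open>s * ?t = 2 * K\<close>, so the exponential Markov
    inequality leaves \<open>exp (K - 2 * K)\<close>.\<close>
  define s where "s = sqrt (K / m) / \<beta>"
  have s: "s \<ge> 0" using assms by (simp add: s_def)
  have st: "s * ?t = 2 * K"
    using assms by (simp add: s_def real_sqrt_mult real_sqrt_divide)
  have ss: "m * (s\<^sup>2 * \<beta>\<^sup>2) = K" using assms by (simp add: s_def power_divide)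
  have fin: "finite ?C" and ne: "?C \<noteq> {}"
    using finite_card_subsets[OF P] card_subsets_nonempty[OF P m(2)] by blast+
  have "measure_pmf.prob (pmf_of_set ?C) {S. F S > ?a + ?t} = avg ?C (\<lambda>S. if F S > ?a + ?t then 1 else 0)"
    using fin ne by (simp add: measure_pmf_of_set avg_def sum.If_cases)
  also have "\<dots> \<le> avg ?C (\<lambda>S. exp (- 2 * K) * exp (s * (F S - ?a)))"
  proof (rule avg_mono)
    fix S
    have "0 \<le> - 2 * K + s * (F S - ?a)" if "F S > ?a + ?t"
      using mult_left_mono[OF less_imp_le[OF that] s] st by (simp add: algebra_simps)
    then show "(if F S > ?a + ?t then 1 else 0) \<le> exp (- 2 * K) * exp (s * (F S - ?a))"
      unfolding exp_add[symmetric] by auto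
  qed
  also have "\<dots> \<le> exp (- 2 * K) * exp (m * (s\<^sup>2 * \<beta>\<^sup>2))"
    unfolding avg_cmult using assms by (intro mult_left_mono avg_subsets_exp_le) auto
  also have "\<dots> = exp (- K)" unfolding ss exp_add[symmetric] by simp
  finally show ?thesis .
qed

section \<open>The largest eigenvalue of a Gram matrix\<close>

lemma scalar_prod_sum: "w \<in> carrier_vec d \<Longrightarrow> v \<bullet> w = (\<Sum>i<d. v $ i * w $ i)"
  by (simp add: scalar_prod_def atLeast0LessThan)

lemma mult_mat_vec_index_sum:
  "A \<in> carrier_mat m n \<Longrightarrow> z \<in> carrier_vec n \<Longrightarrow> i < m \<Longrightarrow> (A *\<^sub>v z) $ i = (\<Sum>j<n. A $$ (i, j) * z $ j)"
  by (simp add: scalar_prod_sum)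

lemma smult_mat_mult_vec:
  assumes "A \<in> carrier_mat m n" "v \<in> carrier_vec n"
  shows "(c \<cdot>\<^sub>m A) *\<^sub>v v = c \<cdot>\<^sub>v (A *\<^sub>v v)"
  using assms by (intro eq_vecI) (auto simp: smult_scalar_prod_distrib[of _ n])

lemma scalar_prod_self_nonneg: "0 \<le> (v :: real Matrix.vec) \<bullet> v"
  by (simp add: scalar_prod_def sum_nonneg)

lemma scalar_prod_Cauchy_Schwarz:
  fixes v w :: "real Matrix.vec"
  assumes "v \<in> carrier_vec n" "w \<in> carrier_vec n"
  shows "(v \<bullet> w)\<^sup>2 \<le> (v \<bullet> v) * (w \<bullet> w)"
  using Cauchy_Schwarz_ineq_sum[of "\<lambda>i. v $ i" "\<lambda>i. w $ i" "{..<n}"] assms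
  by (simp add: scalar_prod_sum power2_eq_square)

lemma eigenvalue_of_real_map_mat:
  assumes K: "(K :: real mat) \<in> carrier_mat n n"
  shows "eigenvalue (map_mat complex_of_real K) (complex_of_real x) \<longleftrightarrow> eigenvalue K x"
proof -
  have Kc: "map_mat complex_of_real K \<in> carrier_mat n n" using K by simp
  have "char_poly (map_mat complex_of_real K) = map_poly complex_of_real (char_poly K)"
    by (rule of_real_hom.char_poly_hom[OF K])
  then show ?thesis
    unfolding eigenvalue_root_char_poly[OF K] eigenvalue_root_char_poly[OF Kc] by simp
qed

text \<open>For an eigenvector \<open>v\<close> one has \<open>e * \<parallel>v\<parallel>\<^sup>2 =
  \<parallel>U v\<parallel>\<^sup>2\<close>, so \<open>e\<close> is a quotient of nonnegative reals.
  This lets facts about the complex spectrum be read off from the real one.\<close>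

lemma Gram_complex_eigenvalue:
  fixes U :: "real mat"
  assumes U: "U \<in> carrier_mat d n"
    and ev: "eigenvector (map_mat complex_of_real (transpose_mat U * U)) v e"
  shows "\<exists>x\<ge>0. e = complex_of_real x"
proof -
  let ?U = "map_mat complex_of_real U"
  have Uc: "?U \<in> carrier_mat d n" using U by simp
  have K: "map_mat complex_of_real (transpose_mat U * U) = transpose_mat ?U * ?U"
    using of_real_hom.mat_hom_mult[of "transpose_mat U" n d U n] U
    by (simp only: transpose_carrier_mat map_mat_transpose[symmetric]) (simp add: map_mat_transpose)
  have v: "v \<in> carrier_vec n" "v \<noteq> 0\<^sub>v n" and eq: "(transpose_mat ?U * ?U) *\<^sub>v v = e \<cdot>\<^sub>v v"
    using ev U unfolding K eigenvector_def by auto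
  have cv: "conjugate v \<in> carrier_vec n" using v by simp
  have w: "?U *\<^sub>v v \<in> carrier_vec d" using Uc v by simp
  have conj: "?U *\<^sub>v conjugate v = conjugate (?U *\<^sub>v v)"
    using U v by (intro eq_vecI) (simp_all add: scalar_prod_def sum_conjugate)
  have "e * (v \<bullet> conjugate v) = (e \<cdot>\<^sub>v v) \<bullet> conjugate v" using v by simp
  also have "\<dots> = (transpose_mat ?U *\<^sub>v (?U *\<^sub>v v)) \<bullet> conjugate v"
    using Uc v by (simp add: eq[symmetric] assoc_mult_mat_vec[of _ n d _ n])
  also have "\<dots> = (?U *\<^sub>v v) \<bullet> conjugate (?U *\<^sub>v v)"
    using transpose_vec_mult_scalar[OF Uc cv w] conj by simp
  finally have e: "e * (v \<bullet> conjugate v) = (?U *\<^sub>v v) \<bullet> conjugate (?U *\<^sub>v v)" .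
  define a b where "a = Re (v \<bullet> conjugate v)" and "b = Re ((?U *\<^sub>v v) \<bullet> conjugate (?U *\<^sub>v v))"
  have "v \<bullet> conjugate v > 0" using v by (subst conjugate_square_greater_0_vec) auto
  then have a: "v \<bullet> conjugate v = complex_of_real a" "a > 0"
    by (auto simp: less_complex_def a_def complex_eq_iff)
  have "(?U *\<^sub>v v) \<bullet> conjugate (?U *\<^sub>v v) \<ge> 0" by (rule conjugate_square_ge_0_vec)
  then have b: "(?U *\<^sub>v v) \<bullet> conjugate (?U *\<^sub>v v) = complex_of_real b" "b \<ge> 0"
    by (auto simp: less_eq_complex_def b_def complex_eq_iff)
  have "e * complex_of_real a = complex_of_real b" using e unfolding a(1) b(1) .
  then have "e = complex_of_real (b / a)" using a(2) by (simp add: field_simps)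
  with a(2) b(2) show ?thesis by (intro exI[of _ "b / a"]) simp
qed

lemma lambda1_ge:
  assumes "K \<in> carrier_mat n n" "eigenvalue K x"
  shows "x \<le> lambda1 K"
  unfolding lambda1_def
  using card_finite_spectrum(1)[OF assms(1)] assms(2) by (intro Max_ge) (auto simp: spectrum_def)

text \<open>A complex eigenvalue exists for \<open>n > 0\<close> and is a nonnegative real, hence
  also a real eigenvalue, below the maximum. For \<open>n = 0\<close> there is no eigenvalue at all
  and \<open>lambda1\<close> would be a maximum over the empty set.\<close>

lemma lambda1_Gram_nonneg:
  assumes U: "U \<in> carrier_mat d n" and n: "n > 0"
  shows "0 \<le> lambda1 (transpose_mat U * U)"
proof -
  let ?K = "transpose_mat U * U"
  have K: "?K \<in> carrier_mat n n" using U by simp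
  then have Kc: "map_mat complex_of_real ?K \<in> carrier_mat n n" by simp
  obtain e where e: "eigenvalue (map_mat complex_of_real ?K) e"
    using spectrum_non_empty[OF Kc n] by (auto simp: spectrum_def)
  then obtain v where "eigenvector (map_mat complex_of_real ?K) v e" by (auto simp: eigenvalue_def)
  from Gram_complex_eigenvalue[OF U this] obtain x where x: "x \<ge> 0" "e = complex_of_real x" by auto
  then show ?thesis
    using lambda1_ge[OF K] e eigenvalue_of_real_map_mat[OF K] by force
qed

lemma mult_pow_mat_vec:
  fixes M :: "real mat"
  assumes M: "M \<in> carrier_mat n n" and z: "z \<in> carrier_vec n"
  shows "(M ^\<^sub>m k) *\<^sub>v z = ((\<lambda>v. M *\<^sub>v v) ^^ k) z"
  using z
proof (induction k arbitrary: z)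
  case (Suc k)
  have "(M ^\<^sub>m Suc k) *\<^sub>v z = (M ^\<^sub>m k) *\<^sub>v (M *\<^sub>v z)"
    using M Suc.prems by (simp add: assoc_mult_mat_vec[of _ n n _ n])
  also have "\<dots> = ((\<lambda>v. M *\<^sub>v v) ^^ k) (M *\<^sub>v z)" using M Suc by simp
  finally show ?case by (simp add: funpow_swap1)
qed (use M in simp)

text \<open>By Cauchy-Schwarz the sequence \<open>\<parallel>M\<^sup>k z\<parallel>\<^sup>2\<close> is log-convex, so a Rayleigh quotient
  above 1 would force geometric growth, which bounded powers exclude.\<close>

lemma bounded_powers_quadratic_form_le:
  fixes M :: "real mat"
  assumes M: "M \<in> carrier_mat n n" and sym: "transpose_mat M = M" and z: "z \<in> carrier_vec n"
    and bound: "\<And>k. norm_bound (M ^\<^sub>m k) c"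
  shows "z \<bullet> (M *\<^sub>v z) \<le> z \<bullet> z"
proof (rule ccontr)
  assume "\<not> z \<bullet> (M *\<^sub>v z) \<le> z \<bullet> z"
  then have gt: "z \<bullet> z < z \<bullet> (M *\<^sub>v z)" by simp
  define x where "x k = ((\<lambda>v. M *\<^sub>v v) ^^ k) z" for k
  define b where "b k = x k \<bullet> x k" for k
  have x: "x k \<in> carrier_vec n" for k
    by (induction k) (use M z in \<open>auto simp: x_def\<close>)
  have x_Suc: "x (Suc k) = M *\<^sub>v x k" for k by (simp add: x_def)
  have b_nonneg: "b k \<ge> 0" for k by (simp add: b_def scalar_prod_self_nonneg)
  \<comment> \<open>By symmetry of \<open>M\<close>, one factor moves across the scalar product:
    \<open>b (Suc k)\<close> is the product of \<open>x k\<close> and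
    \<open>x (Suc (Suc k))\<close>.\<close>
  have convex: "(b (Suc k))\<^sup>2 \<le> b k * b (Suc (Suc k))" for k
  proof -
    have "b (Suc k) = x k \<bullet> x (Suc (Suc k))"
      using transpose_vec_mult_scalar[OF M x x, of "Suc k" k] comm_scalar_prod[OF x x]
      by (simp add: b_def sym x_Suc[symmetric])
    then show ?thesis using scalar_prod_Cauchy_Schwarz[OF x x, of k "Suc (Suc k)"] by (simp add: b_def)
  qed
  have gt': "b 0 < x 0 \<bullet> x 1" using gt by (simp add: b_def x_def)
  have cs: "(x 0 \<bullet> x 1)\<^sup>2 \<le> b 0 * b 1"
    using scalar_prod_Cauchy_Schwarz[OF x x, of 0 1] by (simp add: b_def)
  have b0: "b 0 > 0"
  proof (rule ccontr)
    assume "\<not> b 0 > 0"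
    then have "b 0 = 0" using b_nonneg[of 0] by simp
    with cs gt' show False by (simp add: power2_eq_square) (smt (verit) zero_less_mult_iff)
  qed
  have "b 0 * b 0 < b 0 * b 1"
  proof -
    have "b 0 * b 0 < (x 0 \<bullet> x 1) * (x 0 \<bullet> x 1)" using b0 gt' by (intro mult_strict_mono) auto
    with cs show ?thesis by (simp add: power2_eq_square)
  qed
  then have "b 0 < b 1" using b0 by simp
  \<comment> \<open>The first growth ratio exceeds 1, and log-convexity keeps all later ratios at
    least as large.\<close>
  define q where "q = b 1 / b 0"
  have q: "q > 1" using \<open>b 0 < b 1\<close> b0 by (simp add: q_def)
  have step: "b k > 0 \<and> b (Suc k) \<ge> q * b k" for k
  proof (induction k)
    case 0
    then show ?case using b0 by (simp add: q_def)
  next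
    case (Suc k)
    then have pos: "b (Suc k) > 0" using q by (smt (verit) mult_le_cancel_right1)
    have "b k * (q * b (Suc k)) \<le> b (Suc k) * b (Suc k)" 
      using mult_right_mono[OF conjunct2[OF Suc], of "b (Suc k)"] pos by (simp add: mult_ac)
    also have "\<dots> \<le> b k * b (Suc (Suc k))" using convex[of k] by (simp add: power2_eq_square)
    finally show ?case using Suc pos by simp
  qed
  have growth: "q ^ k * b 0 \<le> b k" for k
  proof (induction k)
    case (Suc k)
    have "q ^ Suc k * b 0 = q * (q ^ k * b 0)" by simp
    also have "\<dots> \<le> q * b k" using Suc q by (intro mult_left_mono) auto
    finally show ?case using step[of k] by simp
  qed simp
  define B where "B = (\<Sum>i<n. (\<Sum>j<n. c * \<bar>z $ j\<bar>)\<^sup>2)"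
  have "b k \<le> B" for k
  proof -
    have "\<bar>x k $ i\<bar> \<le> (\<Sum>j<n. c * \<bar>z $ j\<bar>)" if i: "i < n" for i
    proof -
      have P: "M ^\<^sub>m k \<in> carrier_mat n n" using M by simp
      have "x k $ i = (\<Sum>j<n. (M ^\<^sub>m k) $$ (i, j) * z $ j)"
        unfolding x_def mult_pow_mat_vec[OF M z, symmetric] by (rule mult_mat_vec_index_sum[OF P z i])
      also have "\<bar>\<dots>\<bar> \<le> (\<Sum>j<n. \<bar>(M ^\<^sub>m k) $$ (i, j) * z $ j\<bar>)" by (rule sum_abs)
      also have "\<dots> \<le> (\<Sum>j<n. c * \<bar>z $ j\<bar>)"
        using bound[of k] M i by (intro sum_mono) (auto simp: abs_mult norm_bound_def intro!: mult_right_mono)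
      finally show ?thesis .
    qed
    then have "(x k $ i)\<^sup>2 \<le> (\<Sum>j<n. c * \<bar>z $ j\<bar>)\<^sup>2" if "i < n" for i
      using that by (metis abs_ge_zero power2_abs power_mono)
    then show ?thesis
      unfolding b_def B_def scalar_prod_sum[OF x] by (intro sum_mono) (simp add: power2_eq_square)
  qed
  moreover obtain k where "B / b 0 < q ^ k" using real_arch_pow[OF q] by blast
  ultimately show False using growth[of k] b0 by (simp add: field_simps) (smt (verit))
qed

text \<open>For every \<mu> strictly above \<open>lambda1\<close>, the matrix scaled by 1 / \<mu>
  has spectral radius below 1, hence bounded powers, and its quadratic form is at most that of the
  identity. Letting \<mu> decrease to \<open>lambda1\<close> gives the Rayleigh bound.\<close>

lemma Gram_quadratic_form_le:
  fixes U :: "real mat"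
  assumes U: "U \<in> carrier_mat d n" and n: "n > 0" and z: "z \<in> carrier_vec n"
  shows "(U *\<^sub>v z) \<bullet> (U *\<^sub>v z) \<le> lambda1 (transpose_mat U * U) * (z \<bullet> z)"
proof -
  let ?K = "transpose_mat U * U"
  have K: "?K \<in> carrier_mat n n" using U by simp
  have le: "(U *\<^sub>v z) \<bullet> (U *\<^sub>v z) \<le> \<mu> * (z \<bullet> z)" if \<mu>: "lambda1 ?K < \<mu>" for \<mu>
  proof -
    have pos: "\<mu> > 0" using \<mu> lambda1_Gram_nonneg[OF U n] by simp
    define M where "M = (1 / \<mu>) \<cdot>\<^sub>m ?K"
    have M: "M \<in> carrier_mat n n" using K by (simp add: M_def)
    let ?M = "map_mat complex_of_real M"
    have Mc: "?M \<in> carrier_mat n n" using M by simp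
    have "M $$ (j, i) = M $$ (i, j)" if "i < n" "j < n" for i j
      using that U comm_scalar_prod[of "col U i" d "col U j"] by (simp add: M_def)
    then have sym: "transpose_mat M = M" using M by (intro eq_matI) auto
    obtain e where e: "eigenvalue ?M e" "spectral_radius ?M = norm e"
      using spectral_radius_mem_max(1)[OF Mc n] by (auto simp: spectrum_def)
    then obtain v where v: "eigenvector ?M v e" by (auto simp: eigenvalue_def)
    have K_M: "map_mat complex_of_real ?K = complex_of_real \<mu> \<cdot>\<^sub>m ?M"
      using pos by (intro eq_matI) (simp_all add: M_def)
    have evK: "eigenvector (map_mat complex_of_real ?K) v (complex_of_real \<mu> * e)"
      using v M smult_mat_mult_vec[OF Mc, of v] unfolding K_M eigenvector_def
      by (auto simp: smult_smult_assoc)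
    from Gram_complex_eigenvalue[OF U this] obtain x
      where x: "x \<ge> 0" "complex_of_real \<mu> * e = complex_of_real x" by auto
    have "x \<le> lambda1 ?K"
      using evK x(2) eigenvalue_of_real_map_mat[OF K, of x]
      by (intro lambda1_ge[OF K]) (auto simp: eigenvalue_def)
    moreover have "\<mu> * norm e = x"
      using arg_cong[OF x(2), of norm] pos x(1) by (simp add: norm_mult)
    ultimately have "\<mu> * norm e < \<mu> * 1" using \<mu> by simp
    then have "spectral_radius ?M < 1" using pos e(2) by (simp only: mult_less_cancel_left_pos)
    from spectral_radius_jnf_norm_bound_less_1_upper_triangular[OF Mc this]
    obtain c where c: "\<And>k. norm_bound (?M ^\<^sub>m k) c" by blast
    have "norm_bound (M ^\<^sub>m k) c" for k
      using c[of k] M unfolding of_real_hom.mat_hom_pow[OF M, symmetric] by (simp add: norm_bound_def)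
    from bounded_powers_quadratic_form_le[OF M sym z this] have "z \<bullet> (M *\<^sub>v z) \<le> z \<bullet> z" .
    moreover have "z \<bullet> (?K *\<^sub>v z) = (U *\<^sub>v z) \<bullet> (U *\<^sub>v z)"
    proof -
      have Uz: "U *\<^sub>v z \<in> carrier_vec d" using U z by simp
      have "z \<bullet> (?K *\<^sub>v z) = (transpose_mat U *\<^sub>v (U *\<^sub>v z)) \<bullet> z"
        using U z comm_scalar_prod[OF z mult_mat_vec_carrier[OF K z]]
        by (simp add: assoc_mult_mat_vec[of _ n d _ n])
      then show ?thesis using transpose_vec_mult_scalar[OF U z Uz] by simp
    qed
    moreover have "z \<bullet> (M *\<^sub>v z) = (1 / \<mu>) * (z \<bullet> (?K *\<^sub>v z))"
    proof -
      have "?K *\<^sub>v z \<in> carrier_vec n" using K z by (rule mult_mat_vec_carrier)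
      then show ?thesis
        using K z by (simp add: M_def smult_mat_mult_vec[OF K z] scalar_prod_smult_distrib[of _ n])
    qed
    ultimately show ?thesis using pos by (simp add: field_simps)
  qed
  show ?thesis
  proof (rule field_le_epsilon)
    fix \<epsilon> :: real assume eps: "\<epsilon> > 0"
    have zz: "z \<bullet> z \<ge> 0" by (rule scalar_prod_self_nonneg)
    \<comment> \<open>The summand 1 in the denominator keeps the choice of \<mu> meaningful when
      \<open>z\<close> is zero.\<close>
    have "(U *\<^sub>v z) \<bullet> (U *\<^sub>v z) \<le> (lambda1 ?K + \<epsilon> / (z \<bullet> z + 1)) * (z \<bullet> z)"
      by (rule le) (use eps zz in auto)
    also have "\<dots> \<le> lambda1 ?K * (z \<bullet> z) + \<epsilon>"
    proof -
      have "\<epsilon> / (z \<bullet> z + 1) * (z \<bullet> z) \<le> \<epsilon>" using eps zz by (simp add: field_simps)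
      then show ?thesis by (simp only: distrib_right)
    qed
    finally show "(U *\<^sub>v z) \<bullet> (U *\<^sub>v z) \<le> lambda1 ?K * (z \<bullet> z) + \<epsilon>" .
  qed
qed

text \<open>The bound passes from \<open>U\<close> to its transpose by duality: for the image
  \<open>z\<close> of \<open>w\<close>, the square of
  \<open>z \<bullet> z = w \<bullet> (U *\<^sub>v z)\<close> is bounded by Cauchy-Schwarz and the
  Rayleigh bound, and one factor \<open>z \<bullet> z\<close> cancels.\<close>

lemma transpose_norm_le:
  fixes U :: "real mat"
  assumes U: "U \<in> carrier_mat d n" and n: "n > 0" and w: "w \<in> carrier_vec d"
  shows "(transpose_mat U *\<^sub>v w) \<bullet> (transpose_mat U *\<^sub>v w) \<le> lambda1 (transpose_mat U * U) * (w \<bullet> w)"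
proof -
  define z where "z = transpose_mat U *\<^sub>v w"
  have z: "z \<in> carrier_vec n" using U w by (simp add: z_def)
  have Uz: "U *\<^sub>v z \<in> carrier_vec d" using U z by simp
  let ?l = "lambda1 (transpose_mat U * U)"
  have "z \<bullet> z = w \<bullet> (U *\<^sub>v z)"
    using transpose_vec_mult_scalar[OF U z w] by (simp add: z_def)
  then have "(z \<bullet> z)\<^sup>2 \<le> (w \<bullet> w) * ((U *\<^sub>v z) \<bullet> (U *\<^sub>v z))"
    using scalar_prod_Cauchy_Schwarz[OF w Uz] by simp
  also have "\<dots> \<le> (w \<bullet> w) * (?l * (z \<bullet> z))"
    by (intro mult_left_mono Gram_quadratic_form_le[OF U n z] scalar_prod_self_nonneg)
  finally have "(z \<bullet> z) * (z \<bullet> z) \<le> (?l * (w \<bullet> w)) * (z \<bullet> z)" by (simp add: power2_eq_square mult_ac)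
  moreover have "0 \<le> ?l * (w \<bullet> w)"
    using lambda1_Gram_nonneg[OF U n] scalar_prod_self_nonneg by simp
  ultimately show ?thesis
    unfolding z_def[symmetric] using scalar_prod_self_nonneg[of z]
    by (metis less_eq_real_def mult_le_cancel_right not_le)
qed

section \<open>Pref-Rank\<close>

lemma pairs_Suc: "pairs (Suc n) = pairs n \<union> (\<lambda>i. (i, n)) ` {..<n}"
  by (auto simp: pairs_def less_Suc_eq)

lemma finite_pairs: "finite (pairs n)"
  by (induction n) (simp_all add: pairs_Suc, simp add: pairs_def)

lemma sum_pairs_Suc: "(\<Sum>k\<in>pairs (Suc n). F k) = (\<Sum>k\<in>pairs n. F k) + (\<Sum>i<n. F (i, n))"
proof -
  have "(\<Sum>k\<in>pairs (Suc n). F k) = (\<Sum>k\<in>pairs n. F k) + (\<Sum>k\<in>(\<lambda>i. (i, n)) ` {..<n}. F k)"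
    unfolding pairs_Suc by (intro sum.union_disjoint finite_pairs) (auto simp: pairs_def)
  also have "(\<Sum>k\<in>(\<lambda>i. (i, n)) ` {..<n}. F k) = (\<Sum>i<n. F (i, n))"
    by (subst sum.reindex) (auto intro: inj_onI)
  finally show ?thesis .
qed

lemma pairs_0: "pairs 0 = {}"
  by (simp add: pairs_def)

lemma card_pairs: "card (pairs n) = n choose 2"
proof (induction n)
  case (Suc n)
  have "card (pairs (Suc n)) = card (pairs n) + n"
    using sum_pairs_Suc[of "\<lambda>_. 1 :: nat" n] by simp
  then show ?case using Suc by (simp add: numeral_2_eq_2)
qed (simp add: pairs_0)

text \<open>The Laplacian of the complete graph is n I - J with J the all-ones matrix; discarding
  the J part leaves the factor n.\<close>

lemma sum_pairs_diff_square:
  fixes z :: "nat \<Rightarrow> real"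
  shows "(\<Sum>k\<in>pairs n. (z (fst k) - z (snd k))\<^sup>2) = n * (\<Sum>i<n. (z i)\<^sup>2) - (\<Sum>i<n. z i)\<^sup>2"
proof (induction n)
  case (Suc n)
  have "(\<Sum>i<n. (z i - z n)\<^sup>2) = (\<Sum>i<n. (z i)\<^sup>2) + n * (z n)\<^sup>2 - 2 * z n * (\<Sum>i<n. z i)"
    by (simp add: power2_diff sum.distrib sum_subtractf sum_distrib_left algebra_simps)
  then show ?case unfolding sum_pairs_Suc Suc by (simp add: power2_sum algebra_simps)
qed (simp add: pairs_0)

lemma sum_pairs_diff_square_le:
  "(\<Sum>k\<in>pairs n. (z (fst k) - z (snd k))\<^sup>2) \<le> n * (\<Sum>i<n. (z i :: real)\<^sup>2)"
  unfolding sum_pairs_diff_square by simp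

lemma utilde_carrier: "U \<in> carrier_mat d n \<Longrightarrow> utilde U k \<in> carrier_vec d"
  by (auto simp: utilde_def)

lemma prefrank_scores_diff:
  assumes U: "U \<in> carrier_mat d n" and w: "w \<in> carrier_vec d" and k: "k \<in> pairs n"
  shows "prefrank_scores U w k
    = (transpose_mat U *\<^sub>v w) $ fst k - (transpose_mat U *\<^sub>v w) $ snd k"
proof -
  have ij: "fst k < n" "snd k < n" using k by (auto simp: pairs_def)
  have "w \<bullet> (col U (fst k) - col U (snd k)) = w \<bullet> col U (fst k) - w \<bullet> col U (snd k)"
    using U w by (intro scalar_prod_minus_distrib[of _ d]) auto
  moreover have "w \<bullet> col U i = (transpose_mat U *\<^sub>v w) $ i" if "i < n" for i
    using U w that comm_scalar_prod[of w d "col U i"] by simp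
  ultimately show ?thesis using ij by (simp add: prefrank_scores_def utilde_def)
qed

lemma prefrank_scores_sum:
  "U \<in> carrier_mat d n \<Longrightarrow> prefrank_scores U w k = (\<Sum>i<d. w $ i * utilde U k $ i)"
  unfolding prefrank_scores_def by (rule scalar_prod_sum[OF utilde_carrier])

lemma sum_prefrank_scores_square_le:
  assumes U: "U \<in> carrier_mat d n" and n: "n > 0" and w: "w \<in> carrier_vec d"
  shows "(\<Sum>k\<in>pairs n. (prefrank_scores U w k)\<^sup>2) \<le> n * lambda1 (transpose_mat U * U) * (w \<bullet> w)"
proof -
  define z where "z = transpose_mat U *\<^sub>v w"
  have z: "z \<in> carrier_vec n" using U w by (simp add: z_def)
  have "(\<Sum>k\<in>pairs n. (prefrank_scores U w k)\<^sup>2) = (\<Sum>k\<in>pairs n. (z $ fst k - z $ snd k)\<^sup>2)"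
    by (intro sum.cong refl) (simp add: prefrank_scores_diff[OF U w] z_def)
  also have "\<dots> \<le> n * (z \<bullet> z)"
    using sum_pairs_diff_square_le[of "vec_index z" n]
    unfolding scalar_prod_sum[OF z] by (simp add: power2_eq_square)
  also have "\<dots> \<le> n * (lambda1 (transpose_mat U * U) * (w \<bullet> w))"
    unfolding z_def by (intro mult_left_mono transpose_norm_le[OF U n w]) auto
  finally show ?thesis by (simp add: mult.assoc)
qed

text \<open>The Laplacian bound is applied to each row of \<open>U\<close>; the squared entries of
  \<open>U\<close> sum to n because its n columns are unit vectors.\<close>

lemma sum_utilde_square_le:
  assumes U: "U \<in> carrier_mat d n" and unit: "\<And>i. i < n \<Longrightarrow> col U i \<bullet> col U i = 1"
  shows "(\<Sum>k\<in>pairs n. \<Sum>t<d. (utilde U k $ t)\<^sup>2) \<le> (real n)\<^sup>2"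
proof -
  have "(\<Sum>k\<in>pairs n. \<Sum>t<d. (utilde U k $ t)\<^sup>2)
    = (\<Sum>t<d. \<Sum>k\<in>pairs n. (U $$ (t, fst k) - U $$ (t, snd k))\<^sup>2)"
    by (subst sum.swap) (use U in \<open>auto simp: utilde_def pairs_def intro!: sum.cong\<close>)
  also have "\<dots> \<le> (\<Sum>t<d. n * (\<Sum>i<n. (U $$ (t, i))\<^sup>2))"
    by (intro sum_mono sum_pairs_diff_square_le)
  also have "\<dots> = n * (\<Sum>i<n. \<Sum>t<d. (U $$ (t, i))\<^sup>2)"
    by (subst sum.swap) (simp add: sum_distrib_left)
  also have "(\<Sum>i<n. \<Sum>t<d. (U $$ (t, i))\<^sup>2) = (\<Sum>i<n. col U i \<bullet> col U i)"
  proof (rule sum.cong[OF refl])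
    fix i assume "i \<in> {..<n}"
    then have i: "i < n" by simp
    have "col U i \<in> carrier_vec d" using U i by simp
    from scalar_prod_sum[OF this, of "col U i"] show "(\<Sum>t<d. (U $$ (t, i))\<^sup>2) = col U i \<bullet> col U i"
      using U i by (simp add: power2_eq_square)
  qed
  also have "\<dots> = n" using unit by simp
  finally show ?thesis by (simp add: power2_eq_square)
qed

text \<open>Comparing the minimizer \<open>w\<close> with \<open>(1 - t) w\<close> as \<open>t\<close> tends to 0 replaces
  the dual description of \<open>w\<close> with box-constrained coefficients.\<close>

lemma prefrank_argmin_norm_le:
  assumes U: "U \<in> carrier_mat d n" and C: "C > 0" and y: "\<And>k. k \<in> S \<Longrightarrow> \<bar>y k\<bar> \<le> 1"
    and w: "prefrank_argmin d U C y S w"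
  shows "w \<bullet> w \<le> C * (\<Sum>k\<in>S. \<bar>prefrank_scores U w k\<bar>)"
proof (rule ccontr)
  let ?s = "prefrank_scores U w"
  let ?T = "C * (\<Sum>k\<in>S. \<bar>?s k\<bar>)"
  let ?Q = "w \<bullet> w"
  assume "\<not> ?Q \<le> ?T"
  then have QT: "?T < ?Q" by simp
  have wc: "w \<in> carrier_vec d" using w by (simp add: prefrank_argmin_def)
  have T: "?T \<ge> 0" using C by (simp add: sum_nonneg)
  then have Q: "?Q > 0" using QT by linarith
  \<comment> \<open>Optimality against \<open>(1 - t) w\<close> gives
    \<open>(1 - t / 2) * ?Q \<le> ?T\<close>. This explicit \<open>t\<close> replaces the limit: the
    inequality becomes \<open>(?Q + ?T) / 2 \<le> ?T\<close>, against
    \<open>?T < ?Q\<close>.\<close>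
  define t where "t = (?Q - ?T) / ?Q"
  have t: "0 < t" "t \<le> 1" using QT T Q by (auto simp: t_def field_simps)
  have tQ: "t * ?Q = ?Q - ?T" using Q by (simp add: t_def)
  let ?v = "(1 - t) \<cdot>\<^sub>v w"
  have vc: "?v \<in> carrier_vec d" using wc by simp
  have vs: "?v \<bullet> utilde U k = (1 - t) * ?s k" for k
    using wc utilde_carrier[OF U] by (simp add: prefrank_scores_def)
  have vv: "?v \<bullet> ?v = (1 - t)\<^sup>2 * ?Q" using wc by (simp add: power2_eq_square)
  have "prefrank_obj U C y S w \<le> prefrank_obj U C y S ?v"
    using w vc by (simp add: prefrank_argmin_def)
  also have "\<dots> = (1/2) * ((1 - t)\<^sup>2 * ?Q) + C * (\<Sum>k\<in>S. max 0 (1 - y k * ((1 - t) * ?s k)))"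
    unfolding prefrank_obj_def vs vv ..
  \<comment> \<open>The hinge is 1-Lipschitz and labels have modulus at most 1, so shrinking the
    scores raises each hinge term by at most \<open>t * \<bar>?s k\<bar>\<close>.\<close>
  also have "\<dots> \<le> (1/2) * ((1 - t)\<^sup>2 * ?Q) + C * (\<Sum>k\<in>S. max 0 (1 - y k * ?s k) + t * \<bar>?s k\<bar>)"
  proof (intro add_left_mono mult_left_mono sum_mono)
    fix k assume "k \<in> S"
    then have "\<bar>y k\<bar> * (t * \<bar>?s k\<bar>) \<le> 1 * (t * \<bar>?s k\<bar>)"
      using y t by (intro mult_right_mono) auto
    then have "\<bar>y k * (t * ?s k)\<bar> \<le> t * \<bar>?s k\<bar>" using t by (simp add: abs_mult)
    then have "1 - y k * ((1 - t) * ?s k) \<le> (1 - y k * ?s k) + t * \<bar>?s k\<bar>"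
      by (simp add: algebra_simps)
    moreover have "0 \<le> t * \<bar>?s k\<bar>" using t by simp
    ultimately show "max 0 (1 - y k * ((1 - t) * ?s k)) \<le> max 0 (1 - y k * ?s k) + t * \<bar>?s k\<bar>"
      by linarith
  qed (use C in simp)
  also have "\<dots> = (1/2) * ((1 - t)\<^sup>2 * ?Q) + C * (\<Sum>k\<in>S. max 0 (1 - y k * ?s k)) + t * ?T"
    by (simp add: sum.distrib sum_distrib_left[symmetric] distrib_left mult.left_commute)
  finally have "(1/2) * ?Q \<le> (1/2) * ((1 - t)\<^sup>2 * ?Q) + t * ?T"
    unfolding prefrank_obj_def prefrank_scores_def by linarith
  then have "t * ((1 - t / 2) * ?Q) \<le> t * ?T" by (simp add: power2_eq_square algebra_simps)
  then have "(1 - t / 2) * ?Q \<le> ?T" using t by (simp only: mult_le_cancel_left_pos)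
  then have "?Q - (t * ?Q) / 2 \<le> ?T" by (simp add: algebra_simps)
  then show False unfolding tQ using QT by argo
qed

text \<open>The estimate is self-bounding: Cauchy-Schwarz over \<open>S\<close> and the spectral
  bound control the scores by the norm of \<open>w\<close> itself, and one factor of that norm
  cancels.\<close>

lemma prefrank_argmin_L2_le:
  assumes U: "U \<in> carrier_mat d n" and n: "n > 0" and C: "C > 0"
    and S: "S \<subseteq> pairs n" and y: "\<And>k. k \<in> S \<Longrightarrow> \<bar>y k\<bar> \<le> 1"
    and w: "prefrank_argmin d U C y S w"
  shows "L2_set (vec_index w) {..<d} \<le> C * sqrt (card S * (n * lambda1 (transpose_mat U * U)))"
proof -
  let ?s = "prefrank_scores U w" and ?l = "n * lambda1 (transpose_mat U * U)"
  let ?Q = "w \<bullet> w" and ?q = "sqrt (w \<bullet> w)"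
  have wc: "w \<in> carrier_vec d" using w by (simp add: prefrank_argmin_def)
  have Q0: "?Q \<ge> 0" by (rule scalar_prod_self_nonneg)
  have "(\<Sum>k\<in>S. \<bar>?s k\<bar> * \<bar>1\<bar>) \<le> L2_set ?s S * L2_set (\<lambda>_. 1) S" by (rule L2_set_mult_ineq)
  also have "L2_set (\<lambda>_. 1) S = sqrt (card S)" by (simp add: L2_set_def)
  also have "L2_set ?s S \<le> sqrt (?l * ?Q)"
    unfolding L2_set_def
    by (intro real_sqrt_le_mono order.trans[OF sum_mono2 sum_prefrank_scores_square_le[OF U n wc]]
        finite_pairs S) simp
  finally have "(\<Sum>k\<in>S. \<bar>?s k\<bar>) \<le> sqrt (card S * ?l) * ?q"
    by (simp add: real_sqrt_mult mult_ac mult_right_mono)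
  then have "C * (\<Sum>k\<in>S. \<bar>?s k\<bar>) \<le> C * (sqrt (card S * ?l) * ?q)" using C by simp
  with prefrank_argmin_norm_le[OF U C y w]
  have "?q * ?q \<le> (C * sqrt (card S * ?l)) * ?q" using Q0 by simp
  moreover have "0 \<le> C * sqrt (card S * ?l)"
    using C lambda1_Gram_nonneg[OF U n] by simp
  moreover have "?q \<ge> 0" using Q0 by simp
  ultimately have "?q \<le> C * sqrt (card S * ?l)"
    by (metis less_eq_real_def mult_le_cancel_right not_le)
  then show ?thesis
    unfolding L2_set_def scalar_prod_sum[OF wc] by (simp add: power2_eq_square)
qed

section \<open>Largest gap between test and training error over a finite class\<close>

lemma gap_swap_le:
  fixes h :: "'k \<Rightarrow> real"
  assumes P: "finite P" and S: "S \<subseteq> P" and x: "x \<in> S" and y: "y \<in> P - S"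
    and h: "\<And>k. k \<in> P \<Longrightarrow> 0 \<le> h k \<and> h k \<le> B"
  shows "\<bar>(avg (P - S) h - avg S h)
      - (avg (P - insert y (S - {x})) h - avg (insert y (S - {x})) h)\<bar>
    \<le> B * (1 / card S + 1 / card (P - S))"
proof -
  let ?S = "insert y (S - {x})"
  have fin: "finite S" "finite (P - S)" using P S by (auto intro: finite_subset)
  have P_S: "P - ?S = insert x (P - S - {y})" using x y S by auto
  have "card ?S = Suc (card (S - {x}))" using fin y by (intro card_insert_disjoint) auto
  also have "\<dots> = card S" using fin(1) x by (rule card_Suc_Diff1)
  finally have card1: "card ?S = card S" .
  have "card (P - ?S) = Suc (card (P - S - {y}))"
    unfolding P_S using fin x by (intro card_insert_disjoint) auto
  also have "\<dots> = card (P - S)" using fin(2) y by (rule card_Suc_Diff1)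
  finally have card2: "card (P - ?S) = card (P - S)" .
  have sum1: "sum h ?S = sum h S - h x + h y"
    using fin x y by (simp add: sum_diff1)
  have sum2: "sum h (P - ?S) = sum h (P - S) - h y + h x"
    unfolding P_S using fin x y by (simp add: sum_diff1)
  have "(avg (P - S) h - avg S h) - (avg (P - ?S) h - avg ?S h)
    = (h y - h x) * (1 / card S + 1 / card (P - S))"
    unfolding avg_def card1 card2 sum1 sum2 by (simp add: add_divide_distrib diff_divide_distrib algebra_simps)
  moreover have "\<bar>h y - h x\<bar> \<le> B" using h[of x] h[of y] x y S by (auto simp: subset_iff)
  ultimately show ?thesis by (simp add: abs_mult mult_right_mono)
qed

lemma transductive_uniform_bound:
  fixes l :: "'k \<Rightarrow> 'w \<Rightarrow> real"
  assumes P: "finite P" and m: "0 < m" "m < card P" and W: "finite W" "W \<noteq> {}"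
    and l: "\<And>k w. k \<in> P \<Longrightarrow> w \<in> W \<Longrightarrow> 0 \<le> l k w \<and> l k w \<le> B" and B: "B > 0" and K: "K > 0"
    and mean: "avg {S. S \<subseteq> P \<and> card S = m}
      (\<lambda>S. MAX w\<in>W. avg (P - S) (\<lambda>k. l k w) - avg S (\<lambda>k. l k w)) \<le> A"
  shows "measure_pmf.prob (pmf_of_set {S. S \<subseteq> P \<and> card S = m})
      {S. \<exists>w\<in>W. avg (P - S) (\<lambda>k. l k w) - avg S (\<lambda>k. l k w)
        > A + 2 * (B * (1 / m + 1 / (card P - m))) * sqrt (m * K)} \<le> exp (- K)"
proof -
  let ?g = "\<lambda>S w. avg (P - S) (\<lambda>k. l k w) - avg S (\<lambda>k. l k w)"
  define \<Phi> where "\<Phi> S = (MAX w\<in>W. ?g S w)" for S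
  define \<beta> where "\<beta> = B * (1 / m + 1 / real (card P - m))"
  have \<beta>: "\<beta> > 0" using B m by (simp add: \<beta>_def add_pos_pos)
  have swap: "\<bar>\<Phi> S - \<Phi> (insert y (S - {x}))\<bar> \<le> \<beta>"
    if S: "S \<subseteq> P" "card S = m" "x \<in> S" "y \<in> P - S" for S x y
  proof -
    have "card (P - S) = card P - m" using S P by (simp add: card_Diff_subset finite_subset)
    then have diff: "\<bar>?g S w - ?g (insert y (S - {x})) w\<bar> \<le> \<beta>" if "w \<in> W" for w
      using gap_swap_le[OF P S(1,3,4), of "\<lambda>k. l k w" B] l that S by (simp add: \<beta>_def)
    have "\<Phi> S \<le> \<Phi> (insert y (S - {x})) + \<beta>" "\<Phi> (insert y (S - {x})) \<le> \<Phi> S + \<beta>"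
      unfolding \<Phi>_def by (rule MAX_diff_le[OF W]; use diff in fastforce)+
    then show ?thesis by linarith
  qed
  have "measure_pmf.prob (pmf_of_set {S. S \<subseteq> P \<and> card S = m})
      {S. \<exists>w\<in>W. ?g S w > A + 2 * \<beta> * sqrt (m * K)}
    \<le> measure_pmf.prob (pmf_of_set {S. S \<subseteq> P \<and> card S = m})
      {S. \<Phi> S > avg {S. S \<subseteq> P \<and> card S = m} \<Phi> + 2 * \<beta> * sqrt (m * K)}"
  proof (rule measure_pmf.finite_measure_mono)
    show "{S. \<exists>w\<in>W. ?g S w > A + 2 * \<beta> * sqrt (m * K)}
      \<subseteq> {S. \<Phi> S > avg {S. S \<subseteq> P \<and> card S = m} \<Phi> + 2 * \<beta> * sqrt (m * K)}"
    proof safe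
      fix S w assume "w \<in> W" and gt: "?g S w > A + 2 * \<beta> * sqrt (m * K)"
      have "?g S w \<le> \<Phi> S" unfolding \<Phi>_def using W \<open>w \<in> W\<close> by (intro MAX_geI)
      moreover have "avg {S. S \<subseteq> P \<and> card S = m} \<Phi> \<le> A" using mean by (simp add: \<Phi>_def[abs_def])
      ultimately show "avg {S. S \<subseteq> P \<and> card S = m} \<Phi> + 2 * \<beta> * sqrt (m * K) < \<Phi> S"
        using gt by linarith
    qed
  qed simp
  also have "\<dots> \<le> exp (- K)"
    using m by (intro subsets_concentration[OF P _ _ \<beta> K swap]) auto
  finally show ?thesis using m by (simp add: \<beta>_def of_nat_diff)
qed

lemma transductive_mean_bound:
  fixes l :: "'k \<Rightarrow> 'w \<Rightarrow> real" and v :: "'k \<Rightarrow> nat \<Rightarrow> real"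
  assumes P: "finite P" and r: "0 < r" "r \<le> m" "r \<le> card P - m" and m: "m \<le> card P"
    and W: "finite W" "W \<noteq> {}" and "L \<ge> 0" and D: "D > 0"
    and R: "\<And>w. w \<in> W \<Longrightarrow> L2_set (e w) {..<d} \<le> R"
    and lip: "\<And>k w w'. k \<in> P \<Longrightarrow> w \<in> W \<Longrightarrow> w' \<in> W \<Longrightarrow>
      \<bar>l k w - l k w'\<bar> \<le> L * \<bar>(\<Sum>i<d. e w i * v k i) - (\<Sum>i<d. e w' i * v k i)\<bar>"
    and avg_v: "avg P (\<lambda>k. \<Sum>i<d. (v k i)\<^sup>2) \<le> D"
  shows "avg {S. S \<subseteq> P \<and> card S = m} (\<lambda>S. MAX w\<in>W. avg (P - S) (\<lambda>k. l k w) - avg S (\<lambda>k. l k w))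
    \<le> 2 * L * R * sqrt (D / r)"
proof -
  let ?C = "{S. S \<subseteq> P \<and> card S = m}"
  have "avg ?C (\<lambda>S. MAX w\<in>W. avg (P - S) (\<lambda>k. l k w) - avg S (\<lambda>k. l k w))
    = avg ?C (\<lambda>S. avg {p. p permutes P}
        (\<lambda>p. MAX w\<in>W. avg (P - p ` S) (\<lambda>k. l k w) - avg (p ` S) (\<lambda>k. l k w)))"
    by (rule avg_subsets_permutes[OF P])
  also have "\<dots> \<le> avg ?C (\<lambda>S. 2 * L * R * sqrt (D / r))"
  proof (rule avg_mono)
    fix S assume "S \<in> ?C"
    then have S: "S \<subseteq> P" "card S = m" by auto
    then have "card (P - S) = card P - m" using P by (simp add: card_Diff_subset finite_subset)
    then show "avg {p. p permutes P}
        (\<lambda>p. MAX w\<in>W. avg (P - p ` S) (\<lambda>k. l k w) - avg (p ` S) (\<lambda>k. l k w))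
      \<le> 2 * L * R * sqrt (D / r)"
      using r S by (intro avg_MAX_gap_bound[OF P S(1) _ _ _ W \<open>L \<ge> 0\<close> D R lip avg_v]) auto
  qed
  also have "\<dots> = 2 * L * R * sqrt (D / r)"
    using finite_card_subsets[OF P] card_subsets_nonempty[OF P m] by (intro avg_const)
  finally show ?thesis .
qed

lemma prob_pmf_of_set_mono:
  assumes "finite A" "A \<noteq> {}" "\<And>x. x \<in> A \<Longrightarrow> x \<in> X \<Longrightarrow> x \<in> Y"
  shows "measure_pmf.prob (pmf_of_set A) X \<le> measure_pmf.prob (pmf_of_set A) Y"
proof -
  have "card (A \<inter> X) \<le> card (A \<inter> Y)" using assms by (intro card_mono) auto
  then show ?thesis using assms(1,2) by (simp add: measure_pmf_of_set divide_right_mono)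
qed

lemma prob_pmf_all_le:
  fixes a b :: "'s \<Rightarrow> 'w \<Rightarrow> real"
  assumes "measure_pmf.prob M {S. \<exists>w. Q S w \<and> b S w < a S w} \<le> \<delta>"
  shows "1 - \<delta> \<le> measure_pmf.prob M {S. \<forall>w. Q S w \<longrightarrow> a S w \<le> b S w}"
proof -
  have "{S. \<exists>w. Q S w \<and> b S w < a S w} = UNIV - {S. \<forall>w. Q S w \<longrightarrow> a S w \<le> b S w}"
    by (auto simp: not_le)
  with assms show ?thesis
    using measure_pmf.prob_compl[of "{S. \<forall>w. Q S w \<longrightarrow> a S w \<le> b S w}" M] by simp
qed

text \<open>Since \<open>1 / m + 1 / (N - m)\<close> equals \<open>N / (N - m) / m\<close> and
  \<open>N / (N - m) \<le> 3\<close>, with equality at \<open>N = 3\<close>, \<open>m = 2\<close>,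
  the constant is 2 * 3 = 6. The factor \<open>1 / (1 - f) \<ge> 1\<close> is simply
  inserted.\<close>

lemma sampling_deviation_le:
  fixes m N :: nat and f B K :: real
  assumes N: "3 \<le> N" and m: "0 < m" "real N * f \<le> m" "2 * m \<le> N + 1"
    and f: "0 < f" "f < 1" and B: "B > 0" and K: "K > 0"
  shows "2 * (B * (1 / m + 1 / (real N - m))) * sqrt (m * K) \<le> 6 * B / (1 - f) * sqrt (K / (real N * f))"
proof -
  have u: "real N - m > 0" using N m by linarith
  have sum: "1 / m + 1 / (real N - m) = N / (real N - m) / m"
    using m u by (simp add: field_simps)
  have sq: "sqrt (m * K) / m = sqrt (K / m)"
  proof -
    have "sqrt (K / m) = sqrt (m * K / (real m)\<^sup>2)" using m by (simp add: power2_eq_square)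
    then show ?thesis using m by (simp add: real_sqrt_divide)
  qed
  have "N / (real N - m) \<le> 3" using N m u by (simp add: field_simps)
  then have "2 * B * (N / (real N - m)) * sqrt (K / m) \<le> 2 * B * 3 * sqrt (K / (real N * f))"
    using B K m f N by (intro mult_mono real_sqrt_le_mono divide_left_mono) auto
  also have "\<dots> \<le> 6 * B / (1 - f) * sqrt (K / (real N * f))"
  proof (rule mult_right_mono)
    have "6 * B * (1 - f) \<le> 6 * B" using B f by simp
    then show "2 * B * 3 \<le> 6 * B / (1 - f)" using f by (simp add: field_simps)
  qed (use K N f in simp)
  finally show ?thesis unfolding sum sq[symmetric] by (simp add: mult_ac)
qed

text \<open>The exceptional case of three vertices with two observed pairs: the test set is then
  smaller than the training set and the general estimate misses the constant.  Here the scores of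
  the three pairs are, up to sign, \<open>a\<close>, \<open>b\<close> and \<open>a \<plusminus> b\<close>.\<close>

lemma triangle_excess:
  fixes x a b M :: real
  assumes x: "x = a + b \<or> x = \<bar>a - b\<bar>" and ab: "a \<ge> 0" "b \<ge> 0" and M: "M \<ge> 0"
    and le: "a\<^sup>2 + b\<^sup>2 + x\<^sup>2 \<le> M * (a + b)"
  shows "x + (a + b) / 2 \<le> 4 / 3 * M"
proof -
  define s where "s = a + b"
  have s0: "s \<ge> 0" using ab by (simp add: s_def)
  have sq: "a\<^sup>2 + b\<^sup>2 = (s\<^sup>2 + (a - b)\<^sup>2) / 2" by (simp add: s_def power2_eq_square algebra_simps)
  from x show ?thesis
  proof
    assume x: "x = a + b"
    have le': "3 / 2 * s\<^sup>2 \<le> M * s"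
      using le zero_le_power2[of "a - b"] unfolding sq x s_def[symmetric] by argo
    show ?thesis
    proof (cases "s = 0")
      case True
      then show ?thesis using M x by (simp add: s_def)
    next
      case False
      then have "s > 0" using s0 by simp
      moreover have "(3 / 2 * s) * s \<le> M * s" using le' by (simp add: power2_eq_square)
      ultimately have "3 / 2 * s \<le> M" by (simp only: mult_le_cancel_right_pos)
      then show ?thesis using x M unfolding s_def by argo
    qed
  next
    assume x: "x = \<bar>a - b\<bar>"
    then have "x\<^sup>2 = (a - b)\<^sup>2" by simp
    then have le': "s\<^sup>2 / 2 + 3 / 2 * x\<^sup>2 \<le> M * s" using le unfolding sq s_def[symmetric] by argo
    \<comment> \<open>A completed square: adding 3/4 times the quadratic constraint bounds the
      objective by 91/72, which is just below 4/3 = 96/72.\<close>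
    have "0 \<le> 3 / 8 * (s - 5 / 3 * M)\<^sup>2 + 9 / 8 * (x - 4 / 9 * M)\<^sup>2" by simp
    then have "M * (x + s / 2) \<le> 91 / 72 * M\<^sup>2"
      using le' by (simp add: power2_eq_square algebra_simps)
    also have "\<dots> \<le> M * (4 / 3 * M)" using M by (simp add: power2_eq_square)
    finally have le'': "M * (x + s / 2) \<le> M * (4 / 3 * M)" .
    show ?thesis
    proof (cases "M = 0")
      case True
      then have "s\<^sup>2 / 2 + 3 / 2 * x\<^sup>2 \<le> 0" using le' by simp
      then have "s\<^sup>2 = 0" "x\<^sup>2 = 0" using zero_le_power2[of s] zero_le_power2[of x] by linarith+
      then show ?thesis using M by (simp add: s_def)
    next
      case False
      then have "M > 0" using M by simp
      with le'' show ?thesis unfolding s_def by (simp only: mult_le_cancel_left_pos)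
    qed
  qed
qed

lemma prefrank_scores_square_le:
  assumes U: "U \<in> carrier_mat d n" and w: "w \<in> carrier_vec d"
  shows "(prefrank_scores U w k)\<^sup>2 \<le> (w \<bullet> w) * (\<Sum>t<d. (utilde U k $ t)\<^sup>2)"
  using scalar_prod_Cauchy_Schwarz[OF w utilde_carrier[OF U], of k]
  unfolding prefrank_scores_def scalar_prod_sum[OF utilde_carrier[OF U], of "utilde U k"]
  by (simp add: power2_eq_square)

text \<open>The sum of squared scores has two bounds: 3 \<open>lambda1\<close> times the squared
  norm of \<open>w\<close> from the Laplacian, and 9 times it from the total squared feature norm.
  They bound the left side by \<open>4 * ?l * C\<close> and by \<open>12 * C\<close>; the geometric
  mean of these is the right side, which is how the square root of \<open>lambda1\<close>
  arises.\<close>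

lemma triangle_scores_le:
  assumes U: "U \<in> carrier_mat d 3" and unit: "\<And>i. i < 3 \<Longrightarrow> col U i \<bullet> col U i = 1" and C: "C > 0"
    and S: "S \<subseteq> pairs 3" "card S = 2" and y: "\<And>k. k \<in> S \<Longrightarrow> \<bar>y k\<bar> \<le> 1"
    and w: "prefrank_argmin d U C y S w"
  shows "avg (pairs 3 - S) (\<lambda>k. \<bar>prefrank_scores U w k\<bar>) + avg S (\<lambda>k. \<bar>prefrank_scores U w k\<bar>)
    \<le> 4 * C * sqrt (3 * lambda1 (transpose_mat U * U))"
proof -
  let ?s = "prefrank_scores U w" and ?l = "lambda1 (transpose_mat U * U)"
  have wc: "w \<in> carrier_vec d" using w by (simp add: prefrank_argmin_def)
  have pairs3: "pairs 3 = {(0, 1), (0, 2), (1, 2)}" by (auto simp: pairs_def)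
  have l0: "?l \<ge> 0" by (rule lambda1_Gram_nonneg[OF U]) simp
  have Q0: "w \<bullet> w \<ge> 0" by (rule scalar_prod_self_nonneg)
  have scores: "?s (0, 2) = ?s (0, 1) + ?s (1, 2)"
    by (simp add: prefrank_scores_diff[OF U wc] pairs3)
  have "card (pairs 3 - S) = 1" using S finite_pairs[of 3] by (simp add: card_Diff_subset finite_subset card_pairs numeral_3_eq_3 numeral_2_eq_2)
  then obtain q where q: "pairs 3 - S = {q}" by (auto simp: card_1_singleton_iff)
  obtain a b where ab: "S = {a, b}" "a \<noteq> b" using S(2) by (auto simp: card_2_iff)
  have P: "pairs 3 = {q, a, b}" and qn: "q \<notin> {a, b}" using q ab S(1) by auto
  have rel: "\<bar>?s q\<bar> = \<bar>?s a\<bar> + \<bar>?s b\<bar> \<or> \<bar>?s q\<bar> = \<bar>\<bar>?s a\<bar> - \<bar>?s b\<bar>\<bar>"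
  proof -
    have "?s q = ?s a + ?s b \<or> ?s q = ?s a - ?s b \<or> ?s q = ?s b - ?s a"
    proof -
      have "q \<in> pairs 3" "a \<in> pairs 3" "b \<in> pairs 3" using P by auto
      then have "q = (0, 1) \<or> q = (0, 2) \<or> q = (1, 2)" "a = (0, 1) \<or> a = (0, 2) \<or> a = (1, 2)"
        "b = (0, 1) \<or> b = (0, 2) \<or> b = (1, 2)" unfolding pairs3 by auto
      then show ?thesis using scores qn ab(2) by (elim disjE) auto
    qed
    then show ?thesis by linarith
  qed
  have X: "\<bar>?s q\<bar> + (\<bar>?s a\<bar> + \<bar>?s b\<bar>) / 2 \<le> 4 / 3 * (\<Lambda> * C)"
    if \<Lambda>: "\<Lambda> \<ge> 0" "(\<Sum>k\<in>pairs 3. (?s k)\<^sup>2) \<le> \<Lambda> * (w \<bullet> w)" for \<Lambda>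
  proof (rule triangle_excess[OF rel])
    have "(\<Sum>k\<in>pairs 3. (?s k)\<^sup>2) = (?s q)\<^sup>2 + (?s a)\<^sup>2 + (?s b)\<^sup>2"
      unfolding P using qn ab by simp
    moreover have "w \<bullet> w \<le> C * (\<bar>?s a\<bar> + \<bar>?s b\<bar>)"
      using prefrank_argmin_norm_le[OF U C y w] ab by simp
    then have "\<Lambda> * (w \<bullet> w) \<le> \<Lambda> * (C * (\<bar>?s a\<bar> + \<bar>?s b\<bar>))" using \<Lambda> by (intro mult_left_mono)
    ultimately show "\<bar>?s a\<bar>\<^sup>2 + \<bar>?s b\<bar>\<^sup>2 + \<bar>?s q\<bar>\<^sup>2 \<le> \<Lambda> * C * (\<bar>?s a\<bar> + \<bar>?s b\<bar>)"
      using \<Lambda>(2) by (simp add: mult.assoc)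
  qed (use \<Lambda> C in auto)
  let ?X = "\<bar>?s q\<bar> + (\<bar>?s a\<bar> + \<bar>?s b\<bar>) / 2"
  have X1: "?X \<le> 4 / 3 * (3 * ?l * C)"
    by (rule X) (use sum_prefrank_scores_square_le[OF U _ wc] l0 in auto)
  have X2: "?X \<le> 4 / 3 * (9 * C)"
  proof (rule X)
    have "(\<Sum>k\<in>pairs 3. (?s k)\<^sup>2) \<le> (\<Sum>k\<in>pairs 3. (w \<bullet> w) * (\<Sum>t<d. (utilde U k $ t)\<^sup>2))"
      by (intro sum_mono prefrank_scores_square_le[OF U wc])
    also have "\<dots> = (w \<bullet> w) * (\<Sum>k\<in>pairs 3. \<Sum>t<d. (utilde U k $ t)\<^sup>2)"
      by (simp only: sum_distrib_left)
    also have "\<dots> \<le> (w \<bullet> w) * 9"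
      using sum_utilde_square_le[OF U unit] by (intro mult_left_mono Q0) simp
    finally show "(\<Sum>k\<in>pairs 3. (?s k)\<^sup>2) \<le> 9 * (w \<bullet> w)" by simp
  qed simp
  have "?X\<^sup>2 \<le> (4 / 3 * (3 * ?l * C)) * (4 / 3 * (9 * C))"
    unfolding power2_eq_square using X1 X2 l0 C by (intro mult_mono) auto
  also have "\<dots> = (4 * C * sqrt (3 * ?l))\<^sup>2" using l0 by (simp add: power_mult_distrib power2_eq_square)
  finally have "?X \<le> 4 * C * sqrt (3 * ?l)" by (rule power2_le_imp_le) (use l0 C in simp)
  moreover have "avg (pairs 3 - S) (\<lambda>k. \<bar>?s k\<bar>) = \<bar>?s q\<bar>" unfolding q by (simp add: avg_def)
  moreover have "avg S (\<lambda>k. \<bar>?s k\<bar>) = (\<bar>?s a\<bar> + \<bar>?s b\<bar>) / 2" using ab by (simp add: avg_def)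
  ultimately show ?thesis by argo
qed

section \<open>From the uniform bound to the Pref-Rank guarantee\<close>

lemma er_eq_avg: "er l y T g = avg T (\<lambda>k. l (y k) (g k))"
  by (simp add: er_def avg_def)

lemma pref_label_cases:
  assumes "\<sigma> permutes {..<n}" "k \<in> pairs n"
  shows "pref_label \<sigma> k \<in> {-1, 1}"
proof -
  have "\<sigma> (fst k) \<noteq> \<sigma> (snd k)"
    using assms permutes_inj[OF assms(1)] by (auto simp: pairs_def inj_eq)
  then show ?thesis by (auto simp: pref_label_def sgn_if)
qed

lemma prefrank_failure_prob_le:
  fixes U :: "real mat" and l :: "real \<Rightarrow> real \<Rightarrow> real"
  assumes n: "n \<ge> 3" and U: "U \<in> carrier_mat d n" and unit: "\<And>i. i < n \<Longrightarrow> col U i \<bullet> col U i = 1"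
    and C: "C > 0" and f: "0 < f" "f \<le> 1/2" and \<rho>: "\<rho> > 0" and B: "B > 0"
    and y: "\<And>k. k \<in> pairs n \<Longrightarrow> y k \<in> {-1, 1}"
    and l: "\<forall>y \<in> {-1, 1}. \<forall>a. 0 \<le> l y a \<and> l y a \<le> B"
    and lip: "\<forall>y \<in> {-1, 1}. \<forall>a a'. \<bar>l y a - l y a'\<bar> \<le> (1/\<rho>) * \<bar>a - a'\<bar>"
    and K: "K > 0" and N: "N = n choose 2" and m: "m = nat \<lceil>real N * f\<rceil>"
  shows "measure_pmf.prob (pmf_of_set {S. S \<subseteq> pairs n \<and> card S = m})
      {S. \<exists>w. prefrank_argmin d U C y S w \<and>
         er l y (pairs n - S) (prefrank_scores U w) > er l y S (prefrank_scores U w)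
           + 2 * C * sqrt (real n * lambda1 (transpose_mat U * U)) / (\<rho> * sqrt (f * (1 - f)))
           + 6 * B / (1 - f) * sqrt (K / (real N * f))} \<le> exp (- K)"
proof -
  let ?P = "pairs n" and ?l = "lambda1 (transpose_mat U * U)"
  let ?C = "{S. S \<subseteq> ?P \<and> card S = m}"
  let ?h = "\<lambda>k w. l (y k) (prefrank_scores U w k)"
  let ?g = "\<lambda>S w. avg (?P - S) (\<lambda>k. ?h k w) - avg S (\<lambda>k. ?h k w)"
  define A where "A = 2 * C * sqrt (real n * ?l) / (\<rho> * sqrt (f * (1 - f)))"
  define t where "t = 6 * B / (1 - f) * sqrt (K / (real N * f))"
  define bad where "bad S w \<longleftrightarrow> prefrank_argmin d U C y S w \<and> ?g S w > A + t" for S w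
  have n0: "n > 0" using n by simp
  have l0: "?l \<ge> 0" by (rule lambda1_Gram_nonneg[OF U n0])
  have cardP: "card ?P = N" by (simp add: card_pairs N)
  have two_N: "2 * real N = real n * (real n - 1)"
  proof -
    have "2 * N = n * (n - 1)" unfolding N choose_two by (rule dvd_mult_div_cancel) (cases n; auto)
    then have "real (2 * N) = real (n * (n - 1))" by (rule arg_cong)
    then show ?thesis using n by (simp add: of_nat_diff)
  qed
  have "3 * (3 - 1) \<le> real n * (real n - 1)" using n by (intro mult_mono) auto
  then have N3: "N \<ge> 3" using two_N by simp
  have m_real: "real N * f \<le> m" "real m < real N * f + 1"
    unfolding m using f by (auto simp: of_nat_nat) linarith+
  have Nf: "real N * f > 0" using N3 f by simp
  have m0: "m > 0" using m_real Nf by linarith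
  have "real N * f \<le> real N * (1/2)" using f by (intro mult_left_mono) auto
  then have m2: "2 * m \<le> N + 1" using m_real by linarith
  have mN: "m < N" using m2 N3 by linarith
  have fin: "finite ?C" and ne: "?C \<noteq> {}"
    using finite_card_subsets[OF finite_pairs] card_subsets_nonempty[OF finite_pairs, of m n] cardP mN by auto
  have y1: "\<bar>y k\<bar> \<le> 1" if "k \<in> ?P" for k using y[OF that] by auto
  have hB: "0 \<le> ?h k w \<and> ?h k w \<le> B" if "k \<in> ?P" for k w using l y[OF that] by blast
  have h_lip: "\<bar>?h k w - ?h k w'\<bar> \<le> (1/\<rho>) * \<bar>prefrank_scores U w k - prefrank_scores U w' k\<bar>"
    if "k \<in> ?P" for k w w' using lip y[OF that] by blast
  have avg_v: "avg ?P (\<lambda>k. \<Sum>i<d. (utilde U k $ i)\<^sup>2) \<le> 3"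
  proof -
    have "(real n)\<^sup>2 \<le> 3 * N"
    proof -
      have "2 * (real n)\<^sup>2 = 3 * (real n * (real n - 1)) - real n * (real n - 3)"
        by (simp add: power2_eq_square algebra_simps)
      also have "\<dots> \<le> 3 * (2 * real N)" unfolding two_N using n by simp
      finally show ?thesis by simp
    qed
    then show ?thesis
      using sum_utilde_square_le[OF U unit] N3 by (simp add: avg_def cardP divide_le_eq)
  qed
  have dev: "2 * (B * (1 / m + 1 / (card ?P - m))) * sqrt (m * K) \<le> t"
    using sampling_deviation_le[OF N3 m0 m_real(1) m2 f(1) _ B K] f
mN by (simp add: t_def cardP of_nat_diff)
  have four: "1 / (f * (1 - f)) \<ge> 4"
  proof -
    have "0 \<le> (1 - 2 * f)\<^sup>2" by simp
    then show ?thesis using f by (simp add: power2_eq_square field_simps)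
  qed
  \<comment> \<open>Common frame of both cases: it suffices that a finite class \<open>W\<close>
    with mean largest gap at most \<open>A0\<close> contains, for every bad training set, a vector
    whose gap exceeds \<open>A0 + t\<close>. The triangle uses \<open>A0 = 0\<close>, the general
    case \<open>A0 = A\<close>.\<close>
  have bound: "measure_pmf.prob (pmf_of_set ?C) {S. \<exists>w. bad S w} \<le> exp (- K)"
    if W: "finite W" "W \<noteq> {}" and mean: "avg ?C (\<lambda>S. MAX w\<in>W. ?g S w) \<le> A0"
      and dom: "\<And>S w. S \<in> ?C \<Longrightarrow> bad S w \<Longrightarrow> \<exists>w\<in>W. ?g S w > A0 + t" for W A0
  proof -
    have "measure_pmf.prob (pmf_of_set ?C) {S. \<exists>w. bad S w}
      \<le> measure_pmf.prob (pmf_of_set ?C)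
        {S. \<exists>w\<in>W. ?g S w > A0 + 2 * (B * (1 / m + 1 / (card ?P - m))) * sqrt (m * K)}"
    proof (rule prob_pmf_of_set_mono[OF fin ne])
      fix S assume "S \<in> ?C" "S \<in> {S. \<exists>w. bad S w}"
      with dom obtain w where "w \<in> W" "?g S w > A0 + t" by blast
      with dev show "S \<in> {S. \<exists>w\<in>W. ?g S w > A0 + 2 * (B * (1 / m + 1 / (card ?P - m))) * sqrt (m * K)}"
        by force
    qed
    also have "\<dots> \<le> exp (- K)"
      by (rule transductive_uniform_bound[OF finite_pairs m0 _ W hB B K mean]) (use mN cardP in auto)
    finally show ?thesis .
  qed
  have "measure_pmf.prob (pmf_of_set ?C) {S. \<exists>w. bad S w} \<le> exp (- K)"
  proof (cases "n = 3 \<and> m = 2")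
    case True
    then have n3: "n = 3" and m2: "m = 2" by auto
    have N_3: "N = 3" by (simp add: N n3 numeral_3_eq_3 numeral_2_eq_2)
    let ?z = "0\<^sub>v d :: real Matrix.vec"
    show ?thesis
    proof (rule bound[of "{?z}" 0])
      \<comment> \<open>For the zero vector alone the radius is 0, so there is no complexity term.
        The whole budget \<open>A\<close> remains for moving from \<open>w\<close> to zero by the
        Lipschitz property.\<close>
      have "avg ?C (\<lambda>S. MAX w\<in>{?z}. ?g S w) \<le> 2 * (1/\<rho>) * 0 * sqrt (3 / real 1)"
        by (rule transductive_mean_bound[OF finite_pairs, where e="\<lambda>_ _. 0" and d=d and v="\<lambda>k i. utilde U k $ i"])
          (use avg_v \<rho> m2 N_3 cardP in \<open>auto simp: L2_set_def\<close>)
      then show "avg ?C (\<lambda>S. MAX w\<in>{?z}. ?g S w) \<le> 0" by simp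
      fix S w assume S: "S \<in> ?C" and bad: "bad S w"
      let ?s = "\<lambda>k. \<bar>prefrank_scores U w k\<bar>"
      have z: "prefrank_scores U ?z k = 0" for k
        using utilde_carrier[OF U] by (simp add: prefrank_scores_def)
      have h_diff: "\<bar>?h k w - ?h k ?z\<bar> \<le> (1/\<rho>) * ?s k" if "k \<in> ?P" for k
        using h_lip[OF that, of w ?z] by (simp add: z)
      have "avg (?P - S) (\<lambda>k. ?h k w) \<le> avg (?P - S) (\<lambda>k. ?h k ?z + (1/\<rho>) * ?s k)"
        by (rule avg_mono) (use h_diff in fastforce)
      moreover have "avg S (\<lambda>k. ?h k ?z) \<le> avg S (\<lambda>k. ?h k w + (1/\<rho>) * ?s k)"
        by (rule avg_mono) (use h_diff S in fastforce)
      ultimately have "?g S w \<le> ?g S ?z + (1/\<rho>) * (avg (?P - S) ?s + avg S ?s)"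
        unfolding avg_add avg_cmult by (simp only: distrib_left)
      also have "(1/\<rho>) * (avg (?P - S) ?s + avg S ?s) \<le> A"
      proof -
        have "avg (?P - S) ?s + avg S ?s \<le> 4 * C * sqrt (3 * ?l)"
          unfolding n3
        proof (rule triangle_scores_le)
          show "prefrank_argmin d U C y S w" using bad by (simp add: bad_def)
        qed (use U unit C S y1 m2 n3 in auto)
        then have "(1/\<rho>) * (avg (?P - S) ?s + avg S ?s) \<le> (1/\<rho>) * (4 * C * sqrt (3 * ?l))"
          using \<rho> by (intro mult_left_mono) auto
        also have "\<dots> = (2 * C * sqrt (3 * ?l) / \<rho>) * sqrt 4" by simp
        also have "\<dots> \<le> (2 * C * sqrt (3 * ?l) / \<rho>) * sqrt (1 / (f * (1 - f)))"
          using C \<rho> l0 four by (intro mult_left_mono real_sqrt_le_mono) auto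
        also have "\<dots> = A" by (simp add: A_def n3 real_sqrt_divide)
        finally show ?thesis .
      qed
      finally show "\<exists>w\<in>{?z}. ?g S w > 0 + t" using bad by (auto simp: bad_def)
    qed auto
  next
    case False
    define r where "r = min m (N - m)"
    have r0: "r > 0" using m0 mN by (simp add: r_def)
    \<comment> \<open>Either \<open>r = m\<close>, or rounding makes \<open>m\<close> exceed the
      test size by exactly one. In the second case \<open>n \<ge> 4\<close> gives
      \<open>N = 2 * r + 1 \<ge> 6\<close>, hence \<open>r \<ge> 3\<close>.\<close>
    have ratio: "3 * (m / r) \<le> 4"
    proof (cases "m \<le> N - m")
      case True
      then show ?thesis using m0 by (simp add: r_def)
    next
      case gt: False
      then have r: "r = N - m" and mr: "m = r + 1" using m2 mN unfolding r_def by linarith+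
      have "n \<ge> 4"
      proof (rule ccontr)
        assume "\<not> n \<ge> 4"
        then have "n = 3" using n by simp
        moreover have "N = 3" using two_N \<open>n = 3\<close> by simp
        moreover have "m = 2" using mr r \<open>N = 3\<close> by arith
        ultimately show False using False by blast
      qed
      then have "4 * (4 - 1) \<le> real n * (real n - 1)" by (intro mult_mono) auto
      then have "N \<ge> 6" using two_N by simp
      then have "r \<ge> 3" using mr r by linarith
      then show ?thesis unfolding mr by (simp add: field_simps)
    qed
    \<comment> \<open>One violating minimizer per training set: this keeps the class of weight vectors finite,
      so that every supremum is a maximum.\<close>
    define ws where "ws S = (if \<exists>w. bad S w then SOME w. bad S w else 0\<^sub>v d)" for S
    define R where "R = C * sqrt (m * (n * ?l))"
    have R0: "R \<ge> 0" using C l0 by (simp add: R_def)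
    have ws_bad: "bad S (ws S)" if "bad S w" for S w
      using that by (auto simp: ws_def intro: someI)
    have R: "L2_set (vec_index w) {..<d} \<le> R" if w: "w \<in> ws ` ?C" for w
    proof -
      obtain S where S: "w = ws S" "S \<in> ?C" using w by (rule imageE)
      show ?thesis
      proof (cases "\<exists>w. bad S w")
        case True
        then have "prefrank_argmin d U C y S w" using ws_bad unfolding S(1) bad_def by blast
        from prefrank_argmin_L2_le[OF U n0 C _ _ this] show ?thesis
          using S(2) y1 unfolding R_def by auto
      next
        case False
        then show ?thesis using S(1) R0 by (simp add: ws_def L2_set_def)
      qed
    qed
    have r_le: "r \<le> m" "r \<le> card ?P - m" and m_le: "m \<le> card ?P"
      using mN by (simp_all add: r_def cardP)
    have finW: "finite (ws ` ?C)" "ws ` ?C \<noteq> {}" using fin ne by blast+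
    have mean: "avg ?C (\<lambda>S. MAX w\<in>ws ` ?C. ?g S w) \<le> 2 * (1/\<rho>) * R * sqrt (3 / r)"
    proof (rule transductive_mean_bound[OF finite_pairs r0 r_le m_le finW _ _ R _ avg_v])
      fix k w w' assume "k \<in> ?P"
      from h_lip[OF this] show "\<bar>?h k w - ?h k w'\<bar>
        \<le> (1/\<rho>) * \<bar>(\<Sum>i<d. w $ i * utilde U k $ i) - (\<Sum>i<d. w' $ i * utilde U k $ i)\<bar>"
        by (simp only: prefrank_scores_sum[OF U])
    qed (use \<rho> in simp_all)
    \<comment> \<open>The \<open>sqrt m\<close> in the radius \<open>R\<close> meets
      \<open>sqrt (3 / r)\<close> from the mean bound; only their ratio survives.\<close>
    also have "2 * (1/\<rho>) * R * sqrt (3 / r) = (2 * C * sqrt (n * ?l) / \<rho>) * sqrt (3 * (m / r))"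
      by (simp add: R_def real_sqrt_mult real_sqrt_divide)
    also have "\<dots> \<le> (2 * C * sqrt (n * ?l) / \<rho>) * sqrt (1 / (f * (1 - f)))"
      using C \<rho> l0 four ratio by (intro mult_left_mono real_sqrt_le_mono) auto
    also have "\<dots> = A" by (simp add: A_def real_sqrt_divide)
    finally have mean: "avg ?C (\<lambda>S. MAX w\<in>ws ` ?C. ?g S w) \<le> A" .
    show ?thesis
    proof (rule bound[OF _ _ mean])
      fix S w assume "S \<in> ?C" "bad S w"
      then show "\<exists>w\<in>ws ` ?C. ?g S w > A + t"
        using ws_bad[of S w] by (intro bexI[of _ "ws S"]) (auto simp: bad_def)
    qed (rule finW)+
  qed
  moreover have "er l y (?P - S) (prefrank_scores U w) > er l y S (prefrank_scores U w) + A + t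
    \<longleftrightarrow> ?g S w > A + t" for S w
    unfolding er_eq_avg by argo
  ultimately show ?thesis by (simp only: bad_def A_def t_def)
qed

lemma prefrank_generalization:
  fixes U :: "real mat" and l :: "real \<Rightarrow> real \<Rightarrow> real"
  assumes \<sigma>: "\<sigma> permutes {..<n}" and Lab: "Lab n E d U"
    and C: "C > 0" and f: "0 < f" "f \<le> 1/2" and \<rho>: "\<rho> > 0"
    and l: "\<forall>y \<in> {-1, 1}. \<forall>a. 0 \<le> l y a \<and> l y a \<le> B"
    and lip: "\<forall>y \<in> {-1, 1}. \<forall>a a'. \<bar>l y a - l y a'\<bar> \<le> (1/\<rho>) * \<bar>a - a'\<bar>"
    and \<delta>: "\<delta> > 0"
  shows "1 - \<delta> \<le> measure_pmf.prob (pmf_of_set {S. S \<subseteq> pairs n \<and> card S = nat \<lceil>real (n choose 2) * f\<rceil>})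
      {S. \<forall>w. prefrank_argmin d U C (pref_label \<sigma>) S w \<longrightarrow>
         er l (pref_label \<sigma>) (pairs n - S) (prefrank_scores U w)
           \<le> er l (pref_label \<sigma>) S (prefrank_scores U w)
             + 2 * C * sqrt (real n * lambda1 (transpose_mat U * U)) / (\<rho> * sqrt (f * (1 - f)))
             + 6 * B / (1 - f) * sqrt (ln (1 / \<delta>) / (real (n choose 2) * f))}"
proof -
  let ?N = "n choose 2"
  let ?m = "nat \<lceil>real ?N * f\<rceil>"
  let ?y = "pref_label \<sigma>"
  let ?C = "{S. S \<subseteq> pairs n \<and> card S = ?m}"
  let ?rhs = "\<lambda>S w. er l ?y S (prefrank_scores U w)
    + 2 * C * sqrt (real n * lambda1 (transpose_mat U * U)) / (\<rho> * sqrt (f * (1 - f)))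
    + 6 * B / (1 - f) * sqrt (ln (1 / \<delta>) / (real ?N * f))"
  let ?good = "{S. \<forall>w. prefrank_argmin d U C ?y S w \<longrightarrow> er l ?y (pairs n - S) (prefrank_scores U w) \<le> ?rhs S w}"
  have U: "U \<in> carrier_mat d n" and unit: "\<And>i. i < n \<Longrightarrow> col U i \<bullet> col U i = 1"
    using Lab by (auto simp: Lab_def)
  have y: "?y k \<in> {-1, 1}" if "k \<in> pairs n" for k using \<sigma> that by (rule pref_label_cases)
  have "0 \<le> l 1 0 \<and> l 1 0 \<le> B" using l by blast
  then have B: "B \<ge> 0" by linarith
  have mN: "?m \<le> ?N"
  proof -
    have "real ?N * f \<le> real ?N * 1" using f by (intro mult_left_mono) auto
    then show ?thesis by (simp add: ceiling_le_iff)
  qed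
  have fin: "finite ?C" and ne: "?C \<noteq> {}"
    using finite_card_subsets[OF finite_pairs] card_subsets_nonempty[OF finite_pairs, of ?m n] mN unfolding card_pairs by blast+
  have rhs: "?rhs S w \<ge> 0" if "\<delta> < 1" "S \<subseteq> pairs n" for S w
  proof -
    have "er l ?y S (prefrank_scores U w) \<ge> 0"
      unfolding er_eq_avg
    proof (rule avg_nonneg)
      fix k assume "k \<in> S"
      then have "k \<in> pairs n" using that(2) by auto
      from bspec[OF l y[OF this]] show "0 \<le> l (?y k) (prefrank_scores U w k)" by simp
    qed
    moreover have "sqrt (real n * lambda1 (transpose_mat U * U)) \<ge> 0"
      using lambda1_Gram_nonneg[OF U] by (cases "n = 0") auto
    moreover have "sqrt (ln (1 / \<delta>) / (real ?N * f)) \<ge> 0"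
      using \<delta> f that(1) by (intro real_sqrt_ge_zero divide_nonneg_nonneg) simp_all
    ultimately show ?thesis
      using C f \<rho> B by (intro add_nonneg_nonneg divide_nonneg_nonneg mult_nonneg_nonneg) simp_all
  qed
  \<comment> \<open>The degenerate cases: for \<delta> \<ge> 1 the claimed probability is not
    positive. With at most two vertices \<open>f > 0\<close> forces \<open>m = N\<close>, so the
    test set is empty and its error is 0 by the convention for division by zero; for
    \<open>B = 0\<close> the loss vanishes. In both of these the right side is nonnegative.\<close>
  consider "\<delta> \<ge> 1" | "\<delta> < 1" "n \<le> 2 \<or> B = 0" | "\<delta> < 1" "n \<ge> 3" "B > 0" using B by linarith
  then show ?thesis
  proof cases
    case 1
    then show ?thesis by (intro order.trans[OF _ measure_nonneg]) simp
  next
    case 2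
    have "er l ?y (pairs n - S) (prefrank_scores U w) = 0" if S: "S \<in> ?C" for S w
      using 2(2)
    proof
      assume n: "n \<le> 2"
      have "?m \<ge> ?N"
      proof (cases "n = 2")
        case True
        then show ?thesis using f by (simp add: Suc_le_eq)
      next
        case False
        then show ?thesis using n by (simp add: binomial_eq_0)
      qed
      then have "S = pairs n"
        using S mN card_pairs[of n] by (intro card_subset_eq finite_pairs) auto
      then show ?thesis by (simp add: er_def)
    next
      assume "B = 0"
      then have zero: "l (?y k) a = 0" if "k \<in> pairs n" for k a
        using bspec[OF l y[OF that]] by (simp add: order_antisym)
      show ?thesis unfolding er_eq_avg avg_def by (simp add: zero)
    qed
    then have "measure_pmf.prob (pmf_of_set ?C) UNIV \<le> measure_pmf.prob (pmf_of_set ?C) ?good"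
      using rhs[OF 2(1)] by (intro prob_pmf_of_set_mono[OF fin ne]) auto
    then show ?thesis using \<delta> by simp
  next
    case 3
    have K: "ln (1 / \<delta>) > 0" using 3(1) \<delta> by simp
    have "exp (- ln (1 / \<delta>)) = \<delta>" using \<delta> by (simp add: exp_minus)
    with prefrank_failure_prob_le[OF 3(2) U unit C f \<rho> 3(3) y l lip K refl refl]
    have fail: "measure_pmf.prob (pmf_of_set ?C) {S. \<exists>w. prefrank_argmin d U C ?y S w \<and>
           er l ?y (pairs n - S) (prefrank_scores U w) > ?rhs S w} \<le> \<delta>"
      by (simp only:)
    show ?thesis by (rule prob_pmf_all_le[OF fail])
  qed
qed

theorem theorem4:
  shows "\<exists>C1 > (0::real).
    \<forall>(n::nat) (E :: nat \<Rightarrow> nat \<Rightarrow> bool) (\<sigma> :: nat \<Rightarrow> nat) (d::nat) (U :: real mat)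
      (C::real) (f::real) (B::real) (\<rho>::real) (l :: real \<Rightarrow> real \<Rightarrow> real) (\<delta>::real).
      simple_graph n E \<and> \<sigma> permutes {..<n} \<and> Lab n E d U \<and>
      C > 0 \<and> 0 < f \<and> f \<le> 1/2 \<and> \<rho> > 0 \<and>
      (\<forall>y \<in> {-1, 1}. \<forall>a. 0 \<le> l y a \<and> l y a \<le> B) \<and>
      (\<forall>y \<in> {-1, 1}. \<forall>a a'. \<bar>l y a - l y a'\<bar> \<le> (1/\<rho>) * \<bar>a - a'\<bar>) \<and>
      \<delta> > 0
      \<longrightarrow>
      (let N = n choose 2;
           m = nat \<lceil>real N * f\<rceil>;
           y = pref_label \<sigma>;
           K = transpose_mat U * U
       in measure_pmf.prob (pmf_of_set {S. S \<subseteq> pairs n \<and> card S = m})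
            {S. \<forall>w. prefrank_argmin d U C y S w \<longrightarrow>
               er l y (pairs n - S) (prefrank_scores U w)
                 \<le> er l y S (prefrank_scores U w)
                   + 2 * C * sqrt (real n * lambda1 K) / (\<rho> * sqrt (f * (1 - f)))
                   + C1 * B / (1 - f) * sqrt (ln (1 / \<delta>) / (real N * f))}
          \<ge> 1 - \<delta>)"
proof (intro exI[of _ 6] conjI allI impI, goal_cases)
  case (2 n E \<sigma> d U C f B \<rho> l \<delta>)
  then show ?case unfolding Let_def by (elim conjE) (rule prefrank_generalization)
qed simp

end
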